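(* $HH_0(H^n)$ is isomorphic to the Russell skein module $R_n$ as a $\mathbb{Z}$-module.
   Context: $HH_0(H^n)=H^n/[H^n,H^n]$ is the 0th Hochschild homology, where $[H^n,H^n]$ is the additive subgroup spanned by all commutators $uv-vu$. Arc ring $H^n$. Let $\mathcal{A}=\mathbb{Z}[X]/(X^2)$ with $\Delta(1)=1\otimes X+X\otimes1$, $\Delta(X)=X\otimes X$, $\epsilon(1)=0$, $\epsilon(X)=1$, and let $\mathcal{F}$ be the corresponding two-dimensional TQFT: it sends a union of $r$ circles to $\mathcal{A}^{\otimes r}$, a merge to multiplication, a split to $\Delta$, a birth to the unit and a death to $\epsilon$. Let $B^n$ be the set of isotopy classes of crossingless matchings of $2n$ points on a line, and for $b\in B^n$ let $W(b)$ be its reflection. As an abelian group $H^n=\bigoplus_{a,b\in B^n}{}_b(H^n)_a$ with ${}_b(H^n)_a=\mathcal{F}(W(b)a)$ (up to a grading shift), $W(b)a$ being the collection of circles obtained by gluing $W(b)$ and $a$ along their endpoints. The product ${}_d(H^n)_c\otimes{}_b(H^n)_a\to H^n$ is zero if $b\ne c$, and for $b=c$ is the map ${}_d(H^n)_b\otimes{}_b(H^n)_a\to{}_d(H^n)_a$ obtained by applying $\mathcal{F}$ to the minimal cobordism $W(d)bW(b)a\to W(d)a$ built from the $n$ saddles turning $bW(b)$ into $2n$ vertical lines. Russell skein module $R_n$. A diagram is a crossingless matching of the points $1,\ldots,2n$ with each arc carrying at most one dot. $R_n$ is the $\mathbb{Z}$-module spanned by diagrams modulo the following relations, for $a<b<c<d$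 and diagrams identical away from arcs ending at $a,b,c,d$ (a bar marks a dotted arc). Type I: $[\overline{ab},cd]+[ab,\overline{cd}]=[\overline{ad},bc]+[ad,\overline{bc}]$. Type II: $[\overline{ab},\overline{cd}]=[\overline{ad},\overline{bc}]$. *)

theory Defs
  imports "HOL-Algebra.Free_Abelian_Groups" "HOL-Algebra.AbelCoset"
begin

text \<open>A matching of the points \<open>1, \<dots>, 2n\<close> is the set of its arcs, an arc being the pair
  \<open>(i, j)\<close>, \<open>i < j\<close>, of its endpoints. A crossingless matching is determined up to isotopy by
  this set. The reflection \<open>W(b)\<close> has the same set of arcs as \<open>b\<close>.\<close>

type_synonym matching = "(nat \<times> nat) set"

definition crossingless_matchings :: "nat \<Rightarrow> matching set" where
  "crossingless_matchings n =
    {m. m \<subseteq> {(i, j). 1 \<le> i \<and> i < j \<and> j \<le> 2 * n}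
      \<and> (\<forall>k\<in>{1..2 * n}. \<exists>!e. e \<in> m \<and> (k = fst e \<or> k = snd e))
      \<and> \<not> (\<exists>i j k l. (i, k) \<in> m \<and> (j, l) \<in> m \<and> i < j \<and> j < k \<and> k < l)}"

text \<open>\<open>\<A> = \<int>[X]/(X\<^sup>2)\<close> is the free abelian group on the basis \<open>{1, X}\<close>; multiplication and
  comultiplication are given by their values on basis elements, with \<open>(y, z)\<close> standing for
  \<open>y \<otimes> z\<close>.\<close>

datatype basisA = A1 | AX

fun multA :: "basisA \<Rightarrow> basisA \<Rightarrow> basisA \<Rightarrow>\<^sub>0 int" where
  "multA A1 y = frag_of y"
| "multA AX A1 = frag_of AX"
| "multA AX AX = 0"

fun comultA :: "basisA \<Rightarrow> (basisA \<times> basisA) \<Rightarrow>\<^sub>0 int" where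
  "comultA A1 = frag_of (A1, AX) + frag_of (AX, A1)"
| "comultA AX = frag_of (AX, AX)"

text \<open>A closed 1-manifold is given by a set \<open>E\<close> of edges between marked points; its circles are
  the connected components, each recorded as the set of marked points on it.\<close>

definition circle_of :: "('p \<times> 'p) set \<Rightarrow> 'p \<Rightarrow> 'p set" where
  "circle_of E p = (E \<union> E\<inverse>)\<^sup>* `` {p}"

definition circles :: "('p \<times> 'p) set \<Rightarrow> 'p set set" where
  "circles E = circle_of E ` Field E"

text \<open>\<open>\<F>(E)\<close>, the tensor power of \<open>\<A>\<close> indexed by the circles of \<open>E\<close>, is the free abelian group on
  the labellings of the circles by basis elements of \<open>\<A>\<close>.\<close>

type_synonym 'p labelling = "'p set \<Rightarrow> basisA"

definition labellings :: "('p \<times> 'p) set \<Rightarrow> 'p labelling set" where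
  "labellings E = circles E \<rightarrow>\<^sub>E UNIV"

text \<open>\<open>\<F>\<close> of a merge of the circles \<open>c1\<close>, \<open>c2\<close> to \<open>c\<close>, and of a split of \<open>c\<close> into \<open>c1\<close>, \<open>c2\<close>, on a
  basis element; \<open>E'\<close> is the resulting 1-manifold. The labels of all other circles are kept.\<close>

definition F_merge ::
  "('p \<times> 'p) set \<Rightarrow> 'p set \<Rightarrow> 'p set \<Rightarrow> 'p set \<Rightarrow> 'p labelling \<Rightarrow> 'p labelling \<Rightarrow>\<^sub>0 int" where
  "F_merge E' c1 c2 c l =
    frag_extend (\<lambda>z. frag_of (restrict (l(c := z)) (circles E'))) (multA (l c1) (l c2))"

definition F_split ::
  "('p \<times> 'p) set \<Rightarrow> 'p set \<Rightarrow> 'p set \<Rightarrow> 'p set \<Rightarrow> 'p labelling \<Rightarrow> 'p labelling \<Rightarrow>\<^sub>0 int" where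
  "F_split E' c c1 c2 l =
    frag_extend (\<lambda>(y, z). frag_of (restrict (l(c1 := y, c2 := z)) (circles E'))) (comultA (l c))"

text \<open>\<open>\<F>\<close> of a saddle from \<open>E\<close> to \<open>E'\<close> that replaces two edges, one containing \<open>p\<close> and one
  containing \<open>q\<close>, by two edges, one containing \<open>p\<close> and one containing \<open>p'\<close>.\<close>

definition F_saddle ::
  "('p \<times> 'p) set \<Rightarrow> ('p \<times> 'p) set \<Rightarrow> 'p \<Rightarrow> 'p \<Rightarrow> 'p \<Rightarrow> 'p labelling \<Rightarrow> 'p labelling \<Rightarrow>\<^sub>0 int" where
  "F_saddle E E' p q p' l =
    (if circle_of E p \<noteq> circle_of E q
     then F_merge E' (circle_of E p) (circle_of E q) (circle_of E' p) l
     else F_split E' (circle_of E p) (circle_of E' p) (circle_of E' p') l)"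

text \<open>\<open>W(d)bW(b)a\<close> has marked points \<open>(0, i)\<close>, where \<open>W(d)\<close> meets \<open>b\<close>, and \<open>(1, i)\<close>, where \<open>W(b)\<close>
  meets \<open>a\<close>. \<open>stacked d b T a\<close> is obtained from it by performing the saddles at the arcs in
  \<open>T \<subseteq> b\<close>: the two copies of such an arc \<open>(i, j)\<close> are replaced by vertical lines at \<open>i\<close> and \<open>j\<close>.\<close>

type_synonym point = "nat \<times> nat"

definition stacked ::
  "matching \<Rightarrow> matching \<Rightarrow> (nat \<times> nat) set \<Rightarrow> matching \<Rightarrow> (point \<times> point) set" where
  "stacked d b T a =
      {((0, i), (0, j)) | i j. (i, j) \<in> d} \<union> {((1, i), (1, j)) | i j. (i, j) \<in> a}
    \<union> {((r, i), (r, j)) | r i j. r \<in> {0, 1} \<and> (i, j) \<in> b - T}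
    \<union> {((0, k), (1, k)) | k. k \<in> Field T}"

fun F_saddles ::
  "matching \<Rightarrow> matching \<Rightarrow> (nat \<times> nat) set \<Rightarrow> matching \<Rightarrow> (nat \<times> nat) list
    \<Rightarrow> point labelling \<Rightarrow> point labelling \<Rightarrow>\<^sub>0 int" where
  "F_saddles d b T a [] l = frag_of l"
| "F_saddles d b T a ((i, j) # es) l =
    frag_extend (F_saddles d b (insert (i, j) T) a es)
      (F_saddle (stacked d b T a) (stacked d b (insert (i, j) T) a) (0, i) (1, i) (0, j) l)"

text \<open>The identifications \<open>\<F>(W(d)b) \<otimes> \<F>(W(b)a) = \<F>(W(d)bW(b)a)\<close> and, once all saddles have been
  performed, \<open>\<F>(stacked d b b a) = \<F>(W(d)a)\<close>, on basis elements.\<close>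

definition juxtapose ::
  "matching \<Rightarrow> matching \<Rightarrow> matching \<Rightarrow> nat labelling \<Rightarrow> nat labelling \<Rightarrow> point labelling" where
  "juxtapose d b a l1 l2 =
    restrict (\<lambda>C. if C \<subseteq> {0} \<times> UNIV then l1 (snd ` C) else l2 (snd ` C))
      (circles (stacked d b {} a))"

definition straighten :: "matching \<Rightarrow> matching \<Rightarrow> point labelling \<Rightarrow> nat labelling" where
  "straighten d a l = restrict (\<lambda>c. l ({0, 1} \<times> c)) (circles (d \<union> a))"

text \<open>The saddles are performed in the order of the left endpoints of the arcs of \<open>b\<close>, so that an
  arc comes before the arcs nested in it. By functoriality of \<open>\<F>\<close> the order does not matter.\<close>

definition F_min_cobordism ::
  "matching \<Rightarrow> matching \<Rightarrow> matching \<Rightarrow> nat labelling \<Rightarrow> nat labelling \<Rightarrow> nat labelling \<Rightarrow>\<^sub>0 int" where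
  "F_min_cobordism d b a l1 l2 =
    frag_extend (\<lambda>l. frag_of (straighten d a l))
      (F_saddles d b {} a (sorted_key_list_of_set fst b) (juxtapose d b a l1 l2))"

text \<open>\<open>(b, a, l)\<close> stands for the basis element \<open>l\<close> of the summand \<open>\<F>(W(b)a)\<close>.\<close>

type_synonym arc_basis = "matching \<times> matching \<times> nat labelling"

definition arc_ring_basis :: "nat \<Rightarrow> arc_basis set" where
  "arc_ring_basis n =
    {(b, a, l). b \<in> crossingless_matchings n \<and> a \<in> crossingless_matchings n
      \<and> l \<in> labellings (b \<union> a)}"

fun arc_basis_mult :: "arc_basis \<Rightarrow> arc_basis \<Rightarrow> arc_basis \<Rightarrow>\<^sub>0 int" where
  "arc_basis_mult (d, c, l1) (b, a, l2) =
    (if b = c then frag_extend (\<lambda>l. frag_of (d, a, l)) (F_min_cobordism d b a l1 l2) else 0)"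

definition arc_ring :: "nat \<Rightarrow> (arc_basis \<Rightarrow>\<^sub>0 int) ring" where
  "arc_ring n =
    \<lparr> carrier = carrier (free_Abelian_group (arc_ring_basis n)),
      monoid.mult = (\<lambda>u v. frag_extend (\<lambda>x. frag_extend (arc_basis_mult x) v) u),
      one = (\<Sum>a\<in>crossingless_matchings n. frag_of (a, a, restrict (\<lambda>_. A1) (circles a))),
      zero = 0,
      add = (+) \<rparr>"

definition commutator_subgroup :: "('a, 'm) ring_scheme \<Rightarrow> 'a set" where
  "commutator_subgroup R =
    generate (add_monoid R)
      {u \<otimes>\<^bsub>R\<^esub> v \<ominus>\<^bsub>R\<^esub> v \<otimes>\<^bsub>R\<^esub> u | u v. u \<in> carrier R \<and> v \<in> carrier R}"

definition HH0 :: "('a, 'm) ring_scheme \<Rightarrow> 'a set monoid" where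
  "HH0 R = R A_Mod commutator_subgroup R"

text \<open>A diagram is a crossingless matching together with its set of dotted arcs.\<close>

type_synonym diagram = "matching \<times> (nat \<times> nat) set"

definition diagrams :: "nat \<Rightarrow> diagram set" where
  "diagrams n = {(m, D). m \<in> crossingless_matchings n \<and> D \<subseteq> m}"

text \<open>In the relations, \<open>r\<close> is the set of arcs common to all diagrams involved and \<open>D\<close> the set of
  dotted arcs among these.\<close>

definition type_I_relations :: "nat \<Rightarrow> (diagram \<Rightarrow>\<^sub>0 int) set" where
  "type_I_relations n =
    {frag_of (r \<union> {(a, b), (c, d)}, D \<union> {(a, b)}) + frag_of (r \<union> {(a, b), (c, d)}, D \<union> {(c, d)})
     - (frag_of (r \<union> {(a, d), (b, c)}, D \<union> {(a, d)}) + frag_of (r \<union> {(a, d), (b, c)}, D \<union> {(b, c)}))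
     | a b c d r D. a < b \<and> b < c \<and> c < d \<and> D \<subseteq> r
       \<and> r \<union> {(a, b), (c, d)} \<in> crossingless_matchings n
       \<and> r \<union> {(a, d), (b, c)} \<in> crossingless_matchings n}"

definition type_II_relations :: "nat \<Rightarrow> (diagram \<Rightarrow>\<^sub>0 int) set" where
  "type_II_relations n =
    {frag_of (r \<union> {(a, b), (c, d)}, D \<union> {(a, b), (c, d)})
     - frag_of (r \<union> {(a, d), (b, c)}, D \<union> {(a, d), (b, c)})
     | a b c d r D. a < b \<and> b < c \<and> c < d \<and> D \<subseteq> r
       \<and> r \<union> {(a, b), (c, d)} \<in> crossingless_matchings n
       \<and> r \<union> {(a, d), (b, c)} \<in> crossingless_matchings n}"

definition russell_skein_module :: "nat \<Rightarrow> (diagram \<Rightarrow>\<^sub>0 int) set monoid" where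
  "russell_skein_module n =
    free_Abelian_group (diagrams n) Mod
      generate (free_Abelian_group (diagrams n)) (type_I_relations n \<union> type_II_relations n)"

end

theory Submission
  imports Defs
begin

text \<open>A summand \<open>\<^sub>b(H\<^sup>n)\<^sub>a\<close> with \<open>a \<noteq> b\<close> dies in \<open>HH\<^sub>0\<close>, since its elements are commutators with an
  idempotent, while \<open>\<^sub>a(H\<^sup>n)\<^sub>a = \<A>\<^sup>\<otimes>\<^sup>n\<close> has the dottings of \<open>a\<close> as basis (\<open>X\<close> is a dot). The cobordism
  \<open>W(a)bW(b)a \<rightarrow> W(a)a\<close> has one component of genus 0 for each circle of \<open>W(b)a\<close>, so the product
  \<open>\<^sub>a(H\<^sup>n)\<^sub>b \<otimes> \<^sub>b(H\<^sup>n)\<^sub>a \<rightarrow> \<^sub>a(H\<^sup>n)\<^sub>a\<close> is circlewise multiplication followed by an iterated comultiplication onto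
  the arcs of \<open>a\<close> in the circle. If \<open>a\<close> and \<open>b\<close> differ by one surgery, the resulting commutators are
  the relations of types I and II. In general, a commutator compares the same labelling of the
  circles of \<open>W(b)a\<close>, comultiplied onto the arcs of \<open>a\<close> and onto those of \<open>b\<close>; since \<open>a\<close> can be turned
  into \<open>b\<close> by surgeries inside these circles, it is a sum of relations.\<close>

section \<open>Connected components\<close>

text \<open>No surface appears in the proof. The product is defined one saddle at a time, and
  whether a saddle merges or splits depends on the saddles done before it, so an invariant of the
  remaining cobordism is needed. It is the rule that a connected cobordism of genus 0 has
  coefficient 1 exactly when (incoming circles labelled \<open>X\<close>) + (outgoing circles
  labelled \<open>1\<close>) = 1. The rule survives gluing along one circle: the label there is
  either \<open>1\<close>, counted on the side that the circle leaves, or \<open>X\<close>, counted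
  on the side that it enters. A handle would contribute a factor \<open>2X\<close> and break the
  rule. Handles are excluded by a count on graphs: the union of two matchings consists of paths and
  cycles, a path has two ends, and a handle would produce a third. As \<open>HH0\<close> is a
  quotient of the additive group, two kinds of products suffice: those of opposite summands, and
  left multiplication by the idempotent of a matching. The other products of basis elements vanish
  or land off the diagonal, where the map to diagrams is 0.\<close>

definition conn :: "('p \<times> 'p) set \<Rightarrow> ('p \<times> 'p) set" where
  "conn E = (E \<union> E\<inverse>)\<^sup>*"

lemma conn_refl [simp, intro]: "(p, p) \<in> conn E"
  by (simp add: conn_def)

lemma conn_sym: "(p, q) \<in> conn E \<Longrightarrow> (q, p) \<in> conn E"
  unfolding conn_def by (metis converse_Un converse_converse rtrancl_converseI sup_commute)

lemma conn_trans: "(p, q) \<in> conn E \<Longrightarrow> (q, r) \<in> conn E \<Longrightarrow> (p, r) \<in> conn E"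
  unfolding conn_def by (rule rtrancl_trans)

lemma conn_edge: "(p, q) \<in> E \<Longrightarrow> (p, q) \<in> conn E"
  unfolding conn_def by auto

lemma conn_subset: "E \<subseteq> conn E' \<Longrightarrow> conn E \<subseteq> conn E'"
proof -
  assume "E \<subseteq> conn E'"
  then have "E \<union> E\<inverse> \<subseteq> conn E'" by (auto intro: conn_sym)
  then have "(E \<union> E\<inverse>)\<^sup>* \<subseteq> (conn E')\<^sup>*" by (rule rtrancl_mono)
  then show ?thesis unfolding conn_def by simp
qed

lemma conn_mono: "E \<subseteq> E' \<Longrightarrow> conn E \<subseteq> conn E'"
  by (rule conn_subset) (auto intro: conn_edge)

lemma conn_eqI: "E \<subseteq> conn E' \<Longrightarrow> E' \<subseteq> conn E \<Longrightarrow> conn E = conn E'"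
  by (simp add: conn_subset subset_antisym)

lemma in_circle_of: "q \<in> circle_of E p \<longleftrightarrow> (p, q) \<in> conn E"
  by (simp add: circle_of_def conn_def)

lemma circle_of_self [simp]: "p \<in> circle_of E p"
  by (simp add: in_circle_of)

lemma circle_of_eq_iff: "circle_of E p = circle_of E q \<longleftrightarrow> (p, q) \<in> conn E"
  by (auto simp: set_eq_iff in_circle_of intro: conn_trans conn_sym)

lemma circle_of_conn_cong: "conn E = conn E' \<Longrightarrow> circle_of E = circle_of E'"
  by (simp add: fun_eq_iff circle_of_def conn_def)

lemma circles_conn_cong: "conn E = conn E' \<Longrightarrow> Field E = Field E' \<Longrightarrow> circles E = circles E'"
  by (metis circle_of_conn_cong circles_def)

lemma circle_of_subset_closed:
  assumes "p \<in> A" "\<And>x y. (x, y) \<in> E \<Longrightarrow> x \<in> A \<longleftrightarrow> y \<in> A"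
  shows "circle_of E p \<subseteq> A"
proof
  fix q assume "q \<in> circle_of E p"
  then have "(p, q) \<in> (E \<union> E\<inverse>)\<^sup>*" by (simp add: circle_of_def)
  then show "q \<in> A" by (induction rule: rtrancl_induct) (use assms in auto)
qed

lemma circle_of_edge: "(x, y) \<in> E \<Longrightarrow> x \<in> circle_of E p \<longleftrightarrow> y \<in> circle_of E p"
  by (meson conn_edge conn_sym conn_trans in_circle_of)

lemma circle_of_subset_Field: "p \<in> Field E \<Longrightarrow> circle_of E p \<subseteq> Field E"
  by (rule circle_of_subset_closed) (auto simp: Field_def)

lemma circle_of_in_circles: "p \<in> Field E \<Longrightarrow> circle_of E p \<in> circles E"
  by (simp add: circles_def)

lemma circlesD: "c \<in> circles E \<Longrightarrow> p \<in> c \<Longrightarrow> c = circle_of E p"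
  unfolding circles_def by (metis circle_of_eq_iff imageE in_circle_of)

lemma mem_circle_iff: "c \<in> circles E \<Longrightarrow> p \<in> c \<longleftrightarrow> c = circle_of E p"
  using circlesD circle_of_self by metis

lemma circles_nonempty: "c \<in> circles E \<Longrightarrow> c \<noteq> {}"
  unfolding circles_def using circle_of_self by fastforce

lemma circle_subset_circle_of:
  assumes "p \<in> c" "c \<in> circles E" "E \<subseteq> conn E'"
  shows "c \<subseteq> circle_of E' p"
  unfolding circlesD[OF assms(2,1)] using conn_subset[OF assms(3)] by (auto simp: in_circle_of)

lemma finite_circles: "finite E \<Longrightarrow> finite (circles E)"
  by (simp add: circles_def finite_Field)

text \<open>Both kinds of saddle reduce to this. Up to connectivity, a merge adds an edge to the old
  1-manifold, and a split, read backwards, adds an edge to the new one.\<close>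

lemma circle_of_insert:
  assumes "p \<in> Field E" "q \<in> Field E"
  shows "circle_of (insert (p, q) E) k =
    (if k \<in> circle_of E p \<union> circle_of E q then circle_of E p \<union> circle_of E q else circle_of E k)"
    (is "_ = ?R")
proof
  let ?M = "circle_of E p \<union> circle_of E q"
  have sub: "conn E \<subseteq> conn (insert (p, q) E)" by (rule conn_mono) auto
  have pq: "(p, q) \<in> conn (insert (p, q) E)" by (rule conn_edge) auto
  have M: "?M \<subseteq> circle_of (insert (p, q) E) p"
    using sub conn_trans[OF pq] by (auto simp: in_circle_of)
  show "circle_of (insert (p, q) E) k \<subseteq> ?R"
  proof (rule circle_of_subset_closed)
    show "k \<in> ?R" by auto
    fix x y assume xy: "(x, y) \<in> insert (p, q) E"
    show "x \<in> ?R \<longleftrightarrow> y \<in> ?R"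
    proof (cases "(x, y) \<in> E")
      case True then show ?thesis by (auto simp: circle_of_edge)
    next
      case False
      then have "x = p" "y = q" using xy by auto
      then show ?thesis
        by (auto simp: in_circle_of dest: conn_sym)
    qed
  qed
  show "?R \<subseteq> circle_of (insert (p, q) E) k"
  proof (cases "k \<in> ?M")
    case True
    then have "circle_of (insert (p, q) E) k = circle_of (insert (p, q) E) p"
      using M by (metis circle_of_eq_iff conn_sym in_circle_of subsetD)
    then show ?thesis using M True by simp
  next
    case False
    then show ?thesis using sub by (auto simp: in_circle_of)
  qed
qed

lemma circles_insert:
  assumes "p \<in> Field E" "q \<in> Field E"
  shows "circles (insert (p, q) E) =
    insert (circle_of E p \<union> circle_of E q) (circles E - {circle_of E p, circle_of E q})"
proof -
  have F: "Field (insert (p, q) E) = Field E" using assms by (auto simp: Field_def)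
  let ?M = "circle_of E p \<union> circle_of E q"
  have notM: "circle_of E k \<noteq> circle_of E p \<and> circle_of E k \<noteq> circle_of E q \<longleftrightarrow> k \<notin> ?M" for k
    by (auto simp: circle_of_eq_iff in_circle_of dest: conn_sym)
  show ?thesis
  proof (intro equalityI subsetI)
    fix c assume "c \<in> circles (insert (p, q) E)"
    then obtain k where k: "k \<in> Field E" "c = circle_of (insert (p, q) E) k"
      unfolding circles_def F by blast
    then show "c \<in> insert ?M (circles E - {circle_of E p, circle_of E q})"
      unfolding k(2) circle_of_insert[OF assms] using notM[of k]
      by (auto simp: circle_of_in_circles)
  next
    fix c assume c: "c \<in> insert ?M (circles E - {circle_of E p, circle_of E q})"
    show "c \<in> circles (insert (p, q) E)"
    proof (cases "c = ?M")
      case True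
      then have "c = circle_of (insert (p, q) E) p" unfolding circle_of_insert[OF assms] by simp
      then show ?thesis using assms F by (simp add: circle_of_in_circles)
    next
      case False
      then obtain k where k: "k \<in> Field E" "c = circle_of E k" "k \<notin> ?M"
        using c notM unfolding circles_def by (metis DiffE image_iff insertE insertCI)
      then have "c = circle_of (insert (p, q) E) k" unfolding circle_of_insert[OF assms] by auto
      then show ?thesis using k F by (simp add: circle_of_in_circles)
    qed
  qed
qed

section \<open>Partial matchings\<close>

definition pmatch :: "('p \<times> 'p) set \<Rightarrow> bool" where
  "pmatch E \<longleftrightarrow> (\<forall>(x, y)\<in>E. x \<noteq> y) \<and>
     (\<forall>e\<in>E. \<forall>e'\<in>E. {fst e, snd e} \<inter> {fst e', snd e'} \<noteq> {} \<longrightarrow> e = e')"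

text \<open>Unmatched points are fixed, which makes this an involution on all points.\<close>

definition partner :: "('p \<times> 'p) set \<Rightarrow> 'p \<Rightarrow> 'p" where
  "partner E x = (if x \<in> Field E then THE y. (x, y) \<in> E \<or> (y, x) \<in> E else x)"

lemma pmatch_subset: "pmatch E \<Longrightarrow> E' \<subseteq> E \<Longrightarrow> pmatch E'"
  unfolding pmatch_def by blast

lemma pmatch_irrefl: "pmatch E \<Longrightarrow> (x, x) \<notin> E"
  unfolding pmatch_def by blast

lemma pmatch_unique:
  assumes "pmatch E" "(x, y) \<in> E \<or> (y, x) \<in> E" "(x, z) \<in> E \<or> (z, x) \<in> E"
  shows "y = z"
proof -
  have *: "\<And>e e'. e \<in> E \<Longrightarrow> e' \<in> E \<Longrightarrow> {fst e, snd e} \<inter> {fst e', snd e'} \<noteq> {} \<Longrightarrow> e = e'"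
    using assms(1) unfolding pmatch_def by blast
  show ?thesis
    using assms(2,3) *[of "(x, y)" "(x, z)"] *[of "(x, y)" "(z, x)"] *[of "(y, x)" "(x, z)"]
      *[of "(y, x)" "(z, x)"] by auto
qed

lemma partner_eq:
  assumes "pmatch E" "(x, y) \<in> E \<or> (y, x) \<in> E"
  shows "partner E x = y"
proof -
  have "x \<in> Field E" using assms(2) by (auto simp: Field_def)
  then show ?thesis unfolding partner_def
    using assms pmatch_unique[OF assms(1)] by (auto intro!: the_equality)
qed

lemma partner_edge:
  assumes "pmatch E" "x \<in> Field E"
  shows "(x, partner E x) \<in> E \<or> (partner E x, x) \<in> E"
proof -
  obtain y where "(x, y) \<in> E \<or> (y, x) \<in> E" using assms(2) by (auto simp: Field_def)
  then show ?thesis using partner_eq[OF assms(1)] by metis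
qed

lemma partner_notin [simp]: "x \<notin> Field E \<Longrightarrow> partner E x = x"
  by (simp add: partner_def)

lemma partner_partner:
  assumes "pmatch E" shows "partner E (partner E x) = x"
proof (cases "x \<in> Field E")
  case True
  then show ?thesis using partner_edge[OF assms True] partner_eq[OF assms] by metis
qed simp

lemma partner_eq_self_iff: "pmatch E \<Longrightarrow> partner E x = x \<longleftrightarrow> x \<notin> Field E"
  using partner_edge pmatch_irrefl by fastforce

lemma partner_conn:
  assumes "pmatch E" shows "(x, partner E x) \<in> conn E"
  by (metis assms conn_edge conn_refl conn_sym partner_edge partner_notin)

lemma even_card_involution:
  assumes "finite A" "\<And>x. x \<in> A \<Longrightarrow> f x \<in> A \<and> f (f x) = x \<and> f x \<noteq> x"
  shows "even (card A)"
  using assms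
proof (induction A rule: finite_psubset_induct)
  case (psubset A)
  show ?case
  proof (cases "A = {}")
    case False
    then obtain x where x: "x \<in> A" by auto
    let ?B = "A - {x, f x}"
    have "even (card ?B)"
    proof (rule psubset.IH)
      show "?B \<subset> A" using x by auto
      fix y assume "y \<in> ?B"
      then show "f y \<in> ?B \<and> f (f y) = y \<and> f y \<noteq> y" using psubset.prems[of y] psubset.prems[OF x] by auto
    qed
    moreover have "card ?B = card A - 2" "2 \<le> card A"
    proof -
      have s: "{x, f x} \<subseteq> A" and c: "card {x, f x} = 2" using psubset.prems[OF x] x by auto
      show "card ?B = card A - 2" using card_Diff_subset[OF _ s] c by simp
      show "2 \<le> card A" using card_mono[OF psubset.hyps s] c by simp
    qed
    ultimately show ?thesis by auto
  qed simp
qed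

text \<open>Counting parity: both matchings pair up the points of the component.\<close>

lemma other_unmatched_point:
  assumes E: "pmatch E1" "pmatch E2" "finite E1" "finite E2"
    and x: "circle_of (E1 \<union> E2) x \<subseteq> Field E1" "x \<notin> Field E2"
  obtains y where "y \<in> circle_of (E1 \<union> E2) x" "y \<noteq> x" "y \<notin> Field E2"
proof -
  let ?Q = "circle_of (E1 \<union> E2) x"
  have fin: "finite ?Q" using x(1) E(3) by (meson finite_Field finite_subset)
  have p1: "partner E1 y \<in> ?Q" and p2: "partner E2 y \<in> ?Q" if "y \<in> ?Q" for y
    using that partner_conn[OF E(1), of y] partner_conn[OF E(2), of y]
      conn_mono[of E1 "E1 \<union> E2"] conn_mono[of E2 "E1 \<union> E2"]
    by (auto simp: in_circle_of intro: conn_trans)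
  have "even (card ?Q)"
    by (rule even_card_involution[OF fin, of "partner E1"])
      (use p1 x(1) partner_partner[OF E(1)] partner_eq_self_iff[OF E(1)] in blast)
  moreover have "even (card (?Q \<inter> Field E2))"
  proof (rule even_card_involution[where f = "partner E2"])
    fix y assume y: "y \<in> ?Q \<inter> Field E2"
    then have "partner E2 y \<in> Field E2" using partner_edge[OF E(2), of y] by (auto simp: Field_def)
    then show "partner E2 y \<in> ?Q \<inter> Field E2 \<and> partner E2 (partner E2 y) = y \<and> partner E2 y \<noteq> y"
      using y p2 partner_partner[OF E(2)] partner_eq_self_iff[OF E(2)] by auto
  qed (use fin in auto)
  moreover have "card ?Q = card (?Q \<inter> Field E2) + card (?Q - Field E2)"
    by (rule card_Int_Diff[OF fin])
  ultimately have "even (card (?Q - Field E2))" by simp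
  moreover have "x \<in> ?Q - Field E2" using x by simp
  ultimately have "?Q - Field E2 \<noteq> {x}" by auto
  with \<open>x \<in> ?Q - Field E2\<close> show ?thesis using that by blast
qed

text \<open>The walk from an unmatched point that alternates between the two matchings, staying put at
  an unmatched point, is reflected there.\<close>

fun walk :: "('p \<Rightarrow> 'p) \<Rightarrow> ('p \<Rightarrow> 'p) \<Rightarrow> 'p \<Rightarrow> nat \<Rightarrow> 'p" where
  "walk f g x 0 = x"
| "walk f g x (Suc k) = (if even k then f else g) (walk f g x k)"

text \<open>A component of a union of two matchings is a path or a cycle, and a point missed by one
  of them is an end of a path. This is what excludes handles in
  \<open>genus_zero_same_outer\<close>.\<close>

lemma two_unmatched_points:
  assumes E: "pmatch E1" "pmatch E2"
    and xyz: "x \<notin> Field E2" "y \<notin> Field E2" "z \<notin> Field E2"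
    and yz: "y \<in> circle_of (E1 \<union> E2) x" "z \<in> circle_of (E1 \<union> E2) x"
  shows "x = y \<or> x = z \<or> y = z"
proof (rule ccontr)
  assume ne: "\<not> ?thesis"
  define w where "w = walk (partner E1) (partner E2) x"
  have w0: "w 0 = x" and wS: "\<And>k. w (Suc k) = (if even k then partner E1 else partner E2) (w k)"
    by (simp_all add: w_def)
  have prev: "(if even k then partner E1 else partner E2) (w (Suc k)) = w k" for k
    unfolding wS using partner_partner[OF E(1)] partner_partner[OF E(2)] by simp
  have p1: "partner E1 (w k) = (if even k then w (Suc k) else w (k - 1))" for k
    using wS[of k] prev[of "k - 1"] by (cases k) auto
  \<comment> \<open>At \<open>k = 0\<close> the truncated subtraction gives \<open>w 0 = x\<close>,
    as it should, because \<open>E2\<close> misses \<open>x\<close>.\<close>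
  have p2: "partner E2 (w k) = (if odd k then w (Suc k) else w (k - 1))" for k
    using wS[of k] prev[of "k - 1"] w0 xyz(1) by (cases k) auto
  have closed: "circle_of (E1 \<union> E2) x \<subseteq> A"
    if "x \<in> A" "\<And>u. u \<in> A \<Longrightarrow> partner E1 u \<in> A \<and> partner E2 u \<in> A" for A
  proof (rule circle_of_subset_closed[OF that(1)])
    fix u v assume uv: "(u, v) \<in> E1 \<union> E2"
    then have "(partner E1 u = v \<and> partner E1 v = u) \<or> (partner E2 u = v \<and> partner E2 v = u)"
      using partner_eq[OF E(1)] partner_eq[OF E(2)] by blast
    then show "u \<in> A \<longleftrightarrow> v \<in> A" using that(2) by metis
  qed
  have ran: "circle_of (E1 \<union> E2) x \<subseteq> range w"
    by (rule closed) (use p1 p2 w0 in \<open>auto intro: rev_image_eqI[of 0]\<close>)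
  \<comment> \<open>\<open>P k\<close> says that the walk stalls at an \<open>E2\<close> step, so
    that \<open>w k\<close> is an end of the path. Any unmatched point other than \<open>x\<close>
    is visited no earlier than such a stall at that same point.\<close>
  define P where "P k \<longleftrightarrow> odd k \<and> w (Suc k) = w k" for k
  have Pex: "\<exists>k'. P k' \<and> k' \<le> k \<and> w k' = w k" if nf: "w k \<notin> Field E2" and nx: "w k \<noteq> x" for k
  proof (cases "odd k")
    case True then show ?thesis using wS[of k] nf P_def by auto
  next
    case False
    then obtain m where m: "k = Suc m" using nx w0 by (cases k) auto
    then have "w m = w k" "odd m" using prev[of m] nf False by auto
    then show ?thesis using m P_def by auto
  qed
  obtain k where "y = w k" using ran yz(1) by auto
  then have "\<exists>k. P k" using Pex xyz ne by blast
  define p where "p = (LEAST k. P k)"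
  have Pp: "P p" using \<open>\<exists>k. P k\<close> unfolding p_def by (rule LeastI_ex)
  have least: "p \<le> k" if "P k" for k unfolding p_def using that by (rule Least_le)
  \<comment> \<open>Until the first stall the visited points are already closed under both partners,
    so they are the whole component.\<close>
  have "circle_of (E1 \<union> E2) x \<subseteq> w ` {..p}"
  proof (rule closed)
    show "x \<in> w ` {..p}" using w0 by force
    fix u assume "u \<in> w ` {..p}"
    then obtain k where k: "u = w k" "k \<le> p" by auto
    have "w (Suc k) \<in> w ` {..p}"
      using k Pp unfolding P_def by (cases "k = p") auto
    moreover have "w (k - 1) \<in> w ` {..p}" using k by auto
    ultimately show "partner E1 u \<in> w ` {..p} \<and> partner E2 u \<in> w ` {..p}"
      unfolding k p1 p2 by auto
  qed
  \<comment> \<open>A stall at time at most \<open>k \<le> p\<close> can only be the first one, so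
    \<open>w p\<close> is the only unmatched point besides \<open>x\<close>.\<close>
  moreover have "w k = w p" if "k \<le> p" "w k \<notin> Field E2" "w k \<noteq> x" for k
    using Pex[OF that(2,3)] least that(1) by (metis le_antisym le_trans)
  ultimately have "y = w p" "z = w p" using yz xyz ne by blast+
  then show False using ne by simp
qed

section \<open>Stacked matchings\<close>

lemma circles_disjoint: "c \<in> circles E \<Longrightarrow> c' \<in> circles E \<Longrightarrow> c \<inter> c' \<noteq> {} \<Longrightarrow> c = c'"
  using circlesD[of c E] circlesD[of c' E] by blast

lemma crossingless_matchingsD:
  assumes "m \<in> crossingless_matchings n"
  shows "pmatch m" "Field m = {1..2 * n}" "finite m"
proof -
  have sub: "m \<subseteq> {(i, j). 1 \<le> i \<and> i < j \<and> j \<le> 2 * n}"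
    and ex: "\<And>k. k \<in> {1..2 * n} \<Longrightarrow> \<exists>!e. e \<in> m \<and> (k = fst e \<or> k = snd e)"
    using assms unfolding crossingless_matchings_def by auto
  show "pmatch m" unfolding pmatch_def
  proof (intro conjI ballI impI)
    fix e assume "e \<in> m" then show "case e of (x, y) \<Rightarrow> x \<noteq> y" using sub by auto
  next
    fix e e' assume e: "e \<in> m" "e' \<in> m" and "{fst e, snd e} \<inter> {fst e', snd e'} \<noteq> {}"
    then obtain k where k: "k \<in> {fst e, snd e}" "k \<in> {fst e', snd e'}" by blast
    then have "k \<in> {1..2 * n}" using e sub by auto
    from ex[OF this] show "e = e'" using k e by blast
  qed
  show "Field m = {1..2 * n}"
  proof (intro equalityI subsetI)
    fix k assume "k \<in> Field m" then show "k \<in> {1..2 * n}" using sub by (fastforce simp: Field_def)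
  next
    fix k assume "k \<in> {1..2 * n}"
    from ex[OF this] obtain e where "e \<in> m" "k = fst e \<or> k = snd e" by auto
    then show "k \<in> Field m" by (cases e) (auto simp: Field_def)
  qed
  have "m \<subseteq> {1..2 * n} \<times> {1..2 * n}" using sub by auto
  then show "finite m" by (rule finite_subset) auto
qed

section \<open>Counting labelled circles\<close>

lemma finite_labellings: "finite E \<Longrightarrow> finite (labellings E)"
proof -
  have "(UNIV :: basisA set) = {A1, AX}" using basisA.exhaust by auto
  then have "finite (UNIV :: basisA set)" by (metis finite.emptyI finite_insert)
  then show "finite E \<Longrightarrow> finite (labellings E)"
    unfolding labellings_def by (intro finite_PiE finite_circles)
qed

text \<open>In use, \<open>A\<close> is a component of a cobordism, or the set of marked points over
  it, and this counts the circles on its boundary that carry the label \<open>v\<close>.\<close>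

definition count_label :: "('p \<times> 'p) set \<Rightarrow> basisA \<Rightarrow> 'p labelling \<Rightarrow> 'p set \<Rightarrow> nat" where
  "count_label E v l A = (\<Sum>c\<in>circles E. of_bool (l c = v \<and> c \<subseteq> A))"

lemma count_label_circle:
  assumes "finite E" "Q \<in> circles E"
  shows "count_label E v l Q = of_bool (l Q = v)"
proof -
  have "c \<subseteq> Q \<longleftrightarrow> c = Q" if "c \<in> circles E" for c
    using that assms(2) circles_nonempty circles_disjoint by blast
  then have "count_label E v l Q = (\<Sum>c\<in>circles E. if c = Q then of_bool (l c = v) else 0)"
    unfolding count_label_def by (intro sum.cong) auto
  then show ?thesis using assms by (simp add: finite_circles)
qed

lemma count_label_Un:
  assumes "finite E" "A \<inter> B = {}" "\<And>c. c \<in> circles E \<Longrightarrow> c \<subseteq> A \<union> B \<Longrightarrow> c \<subseteq> A \<or> c \<subseteq> B"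
  shows "count_label E v l (A \<union> B) = count_label E v l A + count_label E v l B"
proof -
  have "(of_bool (l c = v \<and> c \<subseteq> A \<union> B) :: nat) = of_bool (l c = v \<and> c \<subseteq> A) + of_bool (l c = v \<and> c \<subseteq> B)"
    if "c \<in> circles E" for c
    using assms(2,3) circles_nonempty[OF that] that by (auto simp: of_bool_def)
  then show ?thesis unfolding count_label_def by (simp add: sum.distrib)
qed

lemma sum_remove_two:
  fixes f :: "'a \<Rightarrow> 'b :: comm_monoid_add"
  assumes "finite X" "x \<in> X" "y \<in> X" "x \<noteq> y"
  shows "sum f X = f x + f y + sum f (X - {x, y})"
proof -
  have "X - {x, y} = X - {x} - {y}" by auto
  then show ?thesis using assms sum.remove[of X x f] sum.remove[of "X - {x}" y f]
    by (simp add: add.assoc)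
qed

text \<open>For \<open>v = AX\<close> the last hypothesis is what multiplication in
  \<open>\<A>\<close> provides: the number of factors \<open>X\<close> is additive, except when both
  are \<open>X\<close> and the product vanishes.\<close>

lemma count_label_merge:
  assumes fin: "finite (circles E)" and c: "c1 \<in> circles E" "c2 \<in> circles E" "c1 \<noteq> c2"
    and E': "circles E' = insert (c1 \<union> c2) (circles E - {c1, c2})"
    and A: "c1 \<subseteq> A \<longleftrightarrow> c2 \<subseteq> A"
    and l: "\<And>c. c \<in> circles E \<Longrightarrow> c \<noteq> c1 \<Longrightarrow> c \<noteq> c2 \<Longrightarrow> l' c = l c"
    and v: "of_bool (l' (c1 \<union> c2) = v) = (of_bool (l c1 = v) + of_bool (l c2 = v) :: nat)"
  shows "count_label E' v l' A = count_label E v l A"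
proof -
  let ?R = "circles E - {c1, c2}"
  have notin: "c1 \<union> c2 \<notin> ?R"
    using c circles_disjoint[of "c1 \<union> c2" E c1] circles_nonempty[of c1 E] by blast
  have "count_label E v l A = of_bool (l c1 = v \<and> c1 \<subseteq> A) + of_bool (l c2 = v \<and> c2 \<subseteq> A)
      + (\<Sum>c\<in>?R. of_bool (l c = v \<and> c \<subseteq> A))"
    unfolding count_label_def by (rule sum_remove_two[OF fin c])
  moreover have "count_label E' v l' A =
      of_bool (l' (c1 \<union> c2) = v \<and> c1 \<union> c2 \<subseteq> A) + (\<Sum>c\<in>?R. of_bool (l' c = v \<and> c \<subseteq> A))"
    unfolding count_label_def E' using notin fin by simp
  moreover have "(\<Sum>c\<in>?R. of_bool (l' c = v \<and> c \<subseteq> A)) = (\<Sum>c\<in>?R. of_bool (l c = v \<and> c \<subseteq> A) :: nat)"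
    by (rule sum.cong) (use l in auto)
  ultimately show ?thesis using v A by (cases "c2 \<subseteq> A") simp_all
qed

text \<open>Together with \<open>middle\<close> this presents a stack as a union of two matchings,
  the form in which the parity and path lemmas apply. The saddles change only
  \<open>middle\<close>.\<close>

definition outer :: "matching \<Rightarrow> matching \<Rightarrow> (point \<times> point) set" where
  "outer d a = {((0, i), (0, j)) | i j. (i, j) \<in> d} \<union> {((1, i), (1, j)) | i j. (i, j) \<in> a}"

definition middle :: "(nat \<times> nat) set \<Rightarrow> nat set \<Rightarrow> (point \<times> point) set" where
  "middle B K = {((r, i), (r, j)) | r i j. r \<in> {0, 1} \<and> (i, j) \<in> B} \<union> {((0, k), (1, k)) | k. k \<in> K}"

lemma stacked_eq: "stacked d b T a = outer d a \<union> middle (b - T) (Field T)"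
  unfolding stacked_def outer_def middle_def by blast

lemma Field_iff: "x \<in> Field E \<longleftrightarrow> (\<exists>y. (x, y) \<in> E \<or> (y, x) \<in> E)"
  by (auto simp: Field_def)

lemma Field_outer: "Field d = V \<Longrightarrow> Field a = V \<Longrightarrow> Field (outer d a) = {0, 1} \<times> V"
proof -
  have "p \<in> Field (outer d a) \<longleftrightarrow> fst p = 0 \<and> snd p \<in> Field d \<or> fst p = 1 \<and> snd p \<in> Field a" for p
    unfolding Field_iff outer_def by (cases p) auto
  then show "Field d = V \<Longrightarrow> Field a = V \<Longrightarrow> Field (outer d a) = {0, 1} \<times> V" by auto
qed

lemma Field_middle: "Field (middle B K) = {0, 1} \<times> (Field B \<union> K)"
proof -
  have "p \<in> Field (middle B K) \<longleftrightarrow> fst p \<in> {0, 1} \<and> (snd p \<in> Field B \<or> snd p \<in> K)" for p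
    unfolding Field_iff middle_def by (cases p) auto
  then show ?thesis by auto
qed

lemma finite_outer: "finite d \<Longrightarrow> finite a \<Longrightarrow> finite (outer d a)"
proof -
  have "outer d a = (\<lambda>(i, j). ((0, i), (0, j))) ` d \<union> (\<lambda>(i, j). ((1, i), (1, j))) ` a"
    unfolding outer_def by auto
  then show "finite d \<Longrightarrow> finite a \<Longrightarrow> finite (outer d a)" by simp
qed

lemma finite_middle: "finite B \<Longrightarrow> finite K \<Longrightarrow> finite (middle B K)"
proof -
  have "middle B K = (\<lambda>(i, j). ((0, i), (0, j))) ` B \<union> (\<lambda>(i, j). ((1, i), (1, j))) ` B
      \<union> (\<lambda>k. ((0, k), (1, k))) ` K"
    unfolding middle_def by auto
  then show "finite B \<Longrightarrow> finite K \<Longrightarrow> finite (middle B K)" by simp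
qed

lemma pmatchI:
  assumes "\<And>x y. (x, y) \<in> E \<Longrightarrow> x \<noteq> y"
    and "\<And>x y x' y'. (x, y) \<in> E \<Longrightarrow> (x', y') \<in> E \<Longrightarrow> x = x' \<or> x = y' \<or> y = x' \<or> y = y' \<Longrightarrow> x = x' \<and> y = y'"
  shows "pmatch E"
  unfolding pmatch_def
proof (intro conjI ballI impI)
  fix e e' assume e: "e \<in> E" "e' \<in> E" and *: "{fst e, snd e} \<inter> {fst e', snd e'} \<noteq> {}"
  obtain x y x' y' where xy: "e = (x, y)" "e' = (x', y')" by (cases e, cases e')
  have "x = x' \<or> x = y' \<or> y = x' \<or> y = y'" using * unfolding xy fst_conv snd_conv by blast
  then show "e = e'" using assms(2)[OF e[unfolded xy]] unfolding xy by blast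
qed (use assms(1) in auto)

lemma pmatchD:
  assumes "pmatch E" "(x, y) \<in> E" "(x', y') \<in> E" "x = x' \<or> x = y' \<or> y = x' \<or> y = y'"
  shows "x = x' \<and> y = y'"
proof -
  have "(x, y) = (x', y')" using assms unfolding pmatch_def by fastforce
  then show ?thesis by simp
qed

lemma pmatch_outer:
  assumes "pmatch d" "pmatch a" shows "pmatch (outer d a)"
proof (rule pmatchI)
  have cases: "\<exists>r i j. x = (r, i) \<and> y = (r, j) \<and> (i, j) \<in> (if r = 0 then d else a)"
    if "(x, y) \<in> outer d a" for x y using that by (auto simp: outer_def)
  have m: "pmatch (if r = 0 then d else a)" for r :: nat using assms by simp
  show "x \<noteq> y" if "(x, y) \<in> outer d a" for x y
    using cases[OF that] pmatch_irrefl[OF m] by auto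
  show "x = x' \<and> y = y'" if xy: "(x, y) \<in> outer d a" "(x', y') \<in> outer d a"
    "x = x' \<or> x = y' \<or> y = x' \<or> y = y'" for x y x' y'
  proof -
    obtain r i j where 1: "x = (r, i)" "y = (r, j)" "(i, j) \<in> (if r = 0 then d else a)"
      using cases[OF xy(1)] by blast
    obtain r' i' j' where 2: "x' = (r', i')" "y' = (r', j')" "(i', j') \<in> (if r' = 0 then d else a)"
      using cases[OF xy(2)] by blast
    have r: "r' = r" and "i = i' \<or> i = j' \<or> j = i' \<or> j = j'" using xy(3) 1 2 by auto
    from pmatchD[OF m 1(3) 2(3)[unfolded r] this(2)] show ?thesis using 1 2 r by simp
  qed
qed

lemma pmatch_middle:
  assumes "pmatch B" "Field B \<inter> K = {}" shows "pmatch (middle B K)"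
proof (rule pmatchI)
  have cases: "(\<exists>r i j. x = (r, i) \<and> y = (r, j) \<and> (i, j) \<in> B \<and> i \<notin> K \<and> j \<notin> K)
      \<or> (\<exists>k\<in>K. x = (0, k) \<and> y = (1, k))"
    if "(x, y) \<in> middle B K" for x y
  proof -
    have "i \<notin> K" "j \<notin> K" if "(i, j) \<in> B" for i j
      using that assms(2) FieldI1[of i j B] FieldI2[of i j B] by blast+
    then show ?thesis using that unfolding middle_def by auto
  qed
  show "x \<noteq> y" if "(x, y) \<in> middle B K" for x y
    using cases[OF that] pmatch_irrefl[OF assms(1)] by auto
  show "x = x' \<and> y = y'" if xy: "(x, y) \<in> middle B K" "(x', y') \<in> middle B K"
    "x = x' \<or> x = y' \<or> y = x' \<or> y = y'" for x y x' y'
    using cases[OF xy(1)]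
  proof
    assume "\<exists>r i j. x = (r, i) \<and> y = (r, j) \<and> (i, j) \<in> B \<and> i \<notin> K \<and> j \<notin> K"
    then obtain r i j where 1: "x = (r, i)" "y = (r, j)" "(i, j) \<in> B" "i \<notin> K" "j \<notin> K" by blast
    then obtain r' i' j' where 2: "x' = (r', i')" "y' = (r', j')" "(i', j') \<in> B"
      using cases[OF xy(2)] xy(3) by auto
    have "r' = r" and "i = i' \<or> i = j' \<or> j = i' \<or> j = j'" using xy(3) 1 2 by auto
    with pmatchD[OF assms(1) 1(3) 2(3)] show ?thesis using 1 2 by simp
  next
    assume "\<exists>k\<in>K. x = (0, k) \<and> y = (1, k)"
    then show ?thesis using cases[OF xy(2)] xy(3) by auto
  qed
qed

lemma pmatch_Field_Diff:
  assumes "pmatch b" "T \<subseteq> b" shows "Field (b - T) = Field b - Field T"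
  using assms(2) pmatchD[OF assms(1)] by (auto simp: Field_def) blast+

locale stack =
  fixes V :: "nat set" and d b a :: matching
  assumes d: "pmatch d" "Field d = V" "finite d"
    and b: "pmatch b" "Field b = V" "finite b"
    and a: "pmatch a" "Field a = V" "finite a"
begin

text \<open>The components of \<open>G T\<close> correspond to those of the cobordism formed by the saddles at
  \<open>b - T\<close>, each of which joins \<open>(0, i)\<close> to \<open>(1, i)\<close>.\<close>

abbreviation "S T \<equiv> stacked d b T a"
abbreviation "G T \<equiv> d \<union> a \<union> (b - T)"

lemma finite_S: "T \<subseteq> b \<Longrightarrow> finite (S T)"
  unfolding stacked_eq using d b a
  by (auto intro!: finite_outer finite_middle finite_Field intro: finite_subset)

lemma Field_S: "T \<subseteq> b \<Longrightarrow> Field (S T) = {0, 1} \<times> V"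
  unfolding stacked_eq Field_Un Field_outer[OF d(2) a(2)] Field_middle
  using pmatch_Field_Diff[OF b(1)] mono_Field[of T b] b(2) by (auto simp: Field_Un)

lemma Field_G: "Field (G T) = V"
  using d(2) a(2) b(2) mono_Field[of "b - T" b] by (auto simp: Field_Un)

lemma conn_proj:
  assumes "(p, q) \<in> conn (S T)" shows "(snd p, snd q) \<in> conn (G T)"
proof -
  have "circle_of (S T) p \<subseteq> {q. snd q \<in> circle_of (G T) (snd p)}"
  proof (rule circle_of_subset_closed)
    fix x y assume "(x, y) \<in> S T"
    then have "(snd x, snd y) \<in> G T \<or> snd x = snd y" by (auto simp: stacked_def)
    then show "x \<in> {q. snd q \<in> circle_of (G T) (snd p)} \<longleftrightarrow> y \<in> {q. snd q \<in> circle_of (G T) (snd p)}"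
      using circle_of_edge[of "snd x" "snd y" "G T"] by auto
  qed simp
  then show ?thesis using assms by (auto simp: in_circle_of)
qed

context
  fixes T i j assumes T: "T \<subseteq> b" and ij: "(i, j) \<in> b - T"
begin

abbreviation (input) "T' \<equiv> insert (i, j) T"
abbreviation (input) "M0 \<equiv> outer d a \<union> middle (b - T') (Field T)"

lemma S_before: "S T = M0 \<union> {((0, i), (0, j)), ((1, i), (1, j))}"
  unfolding stacked_eq middle_def using ij by auto

lemma S_after: "S T' = M0 \<union> {((0, i), (1, i)), ((0, j), (1, j))}"
  unfolding stacked_eq middle_def by (auto simp: Field_insert)

lemma ij_V: "i \<in> V" "j \<in> V" "i \<noteq> j" "T' \<subseteq> b"
  using ij T b(1,2) pmatch_irrefl[of b] by (auto simp: Field_def)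

lemma ij_notin_Field: "i \<notin> Field T" "j \<notin> Field T"
  using ij T pmatchD[OF b(1)] by (auto simp: Field_def) blast+

lemma conn_S_edges:
  "((0, i), (0, j)) \<in> conn (S T)" "((1, i), (1, j)) \<in> conn (S T)"
  "((0, i), (1, i)) \<in> conn (S T')" "((0, j), (1, j)) \<in> conn (S T')"
  by (auto intro!: conn_edge simp: S_before S_after)

text \<open>Cutting out both copies of the arc leaves four points unmatched by the middle part. By
  parity the path from \<open>(0, i)\<close> ends at another of them. Both \<open>(1, i)\<close> and
  \<open>(1, j)\<close> lie on the other circle, so it ends at \<open>(0, j)\<close>. Hence the two
  vertical lines join what is left of both circles into a single one.\<close>

lemma conn_merge:
  assumes ne: "((0, i), (1, i)) \<notin> conn (S T)"
  shows "((0, i), (0, j)) \<in> conn (S T')"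
    "conn (S T') = conn (insert ((0, i), (1, i)) (S T))"
proof -
  let ?x = "(0, i) :: point" and ?y = "(0, j) :: point" and ?z = "(1, i) :: point" and ?w = "(1, j) :: point"
  let ?E2 = "middle (b - T') (Field T)"
  have FB: "Field (b - T') = V - insert i (insert j (Field T))"
    using pmatch_Field_Diff[OF b(1), of T'] ij_V(4) b(2) by (auto simp: Field_insert)
  have unm: "p \<notin> Field ?E2 \<longleftrightarrow> p \<in> {0, 1} \<times> {i, j}" if "p \<in> {0, 1} \<times> V" for p
    using that ij_notin_Field unfolding Field_middle FB by auto
  have E2: "pmatch ?E2" "finite ?E2"
    using b T FB by (auto intro!: pmatch_middle finite_middle finite_Field intro: pmatch_subset finite_subset)
  have FM: "Field M0 = {0, 1} \<times> V"
    using FB ij_V ij_notin_Field mono_Field[OF T] b(2)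
    unfolding Field_Un Field_outer[OF d(2) a(2)] Field_middle by auto
  have xV: "?x \<in> {0, 1} \<times> V" using ij_V by simp
  have sub: "circle_of M0 ?x \<subseteq> Field (outer d a)"
    using circle_of_subset_Field[of ?x M0] xV unfolding FM Field_outer[OF d(2) a(2)] by blast
  obtain y' where y': "y' \<in> circle_of M0 ?x" "y' \<noteq> ?x" "y' \<notin> Field ?E2"
  proof (rule other_unmatched_point[of "outer d a" ?E2 ?x])
    show "?x \<notin> Field ?E2" using unm[OF xV] by simp
  qed (use E2 sub pmatch_outer d a finite_outer in auto)
  have "y' \<in> {0, 1} \<times> V" using y'(1) sub Field_outer[OF d(2) a(2)] by blast
  then have "y' \<in> {0, 1} \<times> {i, j}" using unm y'(3) by blast
  moreover have "conn M0 \<subseteq> conn (S T)" by (rule conn_mono) (auto simp: S_before)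
  then have "(?x, y') \<in> conn (S T)" using y'(1) by (auto simp: in_circle_of)
  moreover have "(?x, ?w) \<notin> conn (S T)"
    using ne conn_S_edges(2) by (meson conn_sym conn_trans)
  ultimately have "y' = ?y" using y'(2) ne by auto
  then have "(?x, ?y) \<in> conn M0" using y'(1) by (simp add: in_circle_of)
  moreover have "conn M0 \<subseteq> conn (S T')" by (rule conn_mono) (auto simp: S_after)
  ultimately show xy: "(?x, ?y) \<in> conn (S T')" by blast
  then have zw: "(?z, ?w) \<in> conn (S T')" using conn_S_edges(3,4) by (meson conn_sym conn_trans)
  have M0: "M0 \<subseteq> conn (S T')" "M0 \<subseteq> conn (insert (?x, ?z) (S T))"
    by (auto intro!: conn_edge simp: S_after S_before)
  have m: "conn (S T) \<subseteq> conn (insert (?x, ?z) (S T))" by (rule conn_mono) auto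
  have xz: "(?x, ?z) \<in> conn (insert (?x, ?z) (S T))" by (rule conn_edge) simp
  then have "(?y, ?w) \<in> conn (insert (?x, ?z) (S T))"
    using m conn_S_edges(1,2) by (meson conn_sym conn_trans subsetD)
  then have 1: "S T' \<subseteq> conn (insert (?x, ?z) (S T))"
    unfolding S_after using M0(2) xz by blast
  have "S T \<subseteq> conn (S T')" unfolding S_before using M0(1) xy zw by blast
  then have 2: "insert (?x, ?z) (S T) \<subseteq> conn (S T')" using conn_S_edges(3) by blast
  show "conn (S T') = conn (insert (?x, ?z) (S T))" by (rule conn_eqI[OF 1 2])
qed

text \<open>Joining \<open>(0, i)\<close> to \<open>(0, j)\<close> undoes the saddle up to
  connectivity. That the two new circles are really different comes later, from the genus hypothesis
  of \<open>straighten_saddle_split\<close>.\<close>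

lemma conn_split:
  assumes "((0, i), (1, i)) \<in> conn (S T)"
  shows "conn (S T) = conn (insert ((0, i), (0, j)) (S T'))"
proof (rule conn_eqI)
  let ?x = "(0, i) :: point" and ?y = "(0, j) :: point" and ?z = "(1, i) :: point" and ?w = "(1, j) :: point"
  let ?I = "insert (?x, ?y) (S T')"
  have m: "conn (S T') \<subseteq> conn ?I" by (rule conn_mono) auto
  have xy: "(?x, ?y) \<in> conn ?I" by (rule conn_edge) simp
  then have "(?z, ?w) \<in> conn ?I" using m conn_S_edges(3,4) by (meson conn_sym conn_trans subsetD)
  moreover have "M0 \<subseteq> conn ?I" by (auto intro!: conn_edge simp: S_after)
  ultimately show "S T \<subseteq> conn ?I" unfolding S_before using xy by blast
  have "(?y, ?w) \<in> conn (S T)" using assms conn_S_edges(1,2) by (meson conn_sym conn_trans)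
  moreover have "M0 \<subseteq> conn (S T)" by (auto intro!: conn_edge simp: S_before)
  ultimately have "S T' \<subseteq> conn (S T)" unfolding S_after using assms by blast
  then show "?I \<subseteq> conn (S T)" using conn_S_edges(1) by blast
qed

lemma G_before: "G T = insert (i, j) (G T')"
  using ij by auto

end

end

section \<open>The minimal cobordism in genus zero\<close>

lemma frag_extend_frag_extend:
  "frag_extend g (frag_extend f x) = frag_extend (\<lambda>y. frag_extend g (f y)) x"
proof (rule frag_induction[of x UNIV])
  fix x y assume "frag_extend g (frag_extend f x) = frag_extend (\<lambda>y. frag_extend g (f y)) x"
    "frag_extend g (frag_extend f y) = frag_extend (\<lambda>y. frag_extend g (f y)) y"
  then show "frag_extend g (frag_extend f (x - y)) = frag_extend (\<lambda>y. frag_extend g (f y)) (x - y)"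
    by (simp add: frag_extend_diff)
qed simp_all

lemma count_label_restrict:
  assumes "X = circles E" shows "count_label E v (restrict l X) A = count_label E v l A"
  unfolding count_label_def assms by (rule sum.cong) auto

context stack
begin

text \<open>A cobordism component of genus 0 has matrix coefficient 1 if the number of incoming
  circles labelled \<open>X\<close> plus the number of outgoing circles labelled \<open>1\<close> is 1, and coefficient 0
  otherwise. Here \<open>f\<close> is the first number, and \<open>l\<close> labels the outgoing circles.\<close>

definition compatible :: "(nat \<times> nat) set \<Rightarrow> (nat set \<Rightarrow> nat) \<Rightarrow> nat labelling set" where
  "compatible T f =
    {l \<in> labellings (d \<union> a). \<forall>Q\<in>circles (G T). f Q + count_label (d \<union> a) A1 l Q = 1}"

lemma compatible_cong:
  "circles (G T) = circles (G U) \<Longrightarrow> (\<And>Q. Q \<in> circles (G U) \<Longrightarrow> f Q = g Q) \<Longrightarrow>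
    compatible T f = compatible U g"
  unfolding compatible_def by simp

lemma finite_compatible: "finite (compatible T f)"
  unfolding compatible_def using d a by (auto intro: finite_subset[OF _ finite_labellings])

text \<open>By \<open>conn_proj\<close> a circle lies over a single component of \<open>G T\<close>,
  so any one of its points decides the inclusion.\<close>

lemma circle_subset_iff:
  assumes "C \<in> circles (S T)" "p \<in> C" "Q \<in> circles (G T)"
  shows "C \<subseteq> UNIV \<times> Q \<longleftrightarrow> snd p \<in> Q"
proof
  assume "C \<subseteq> UNIV \<times> Q" then show "snd p \<in> Q" using assms(2) by auto
next
  assume "snd p \<in> Q"
  then have Q: "Q = circle_of (G T) (snd p)" using circlesD[OF assms(3)] by blast
  have C: "C = circle_of (S T) p" using circlesD[OF assms(1,2)] .
  show "C \<subseteq> UNIV \<times> Q"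
  proof
    fix q assume "q \<in> C"
    then have "snd q \<in> Q" unfolding C Q in_circle_of by (rule conn_proj)
    then show "q \<in> UNIV \<times> Q" by (cases q) auto
  qed
qed

lemma circle_of_S_all:
  assumes "p \<in> {0, 1} \<times> V"
  shows "circle_of (S b) p = {0, 1} \<times> circle_of (d \<union> a) (snd p)"
proof
  show "circle_of (S b) p \<subseteq> {0, 1} \<times> circle_of (d \<union> a) (snd p)"
  proof
    fix q assume q: "q \<in> circle_of (S b) p"
    then have "q \<in> {0, 1} \<times> V" using assms circle_of_subset_Field[of p "S b"] Field_S[of b] by auto
    moreover have "snd q \<in> circle_of (d \<union> a) (snd p)"
      using q conn_proj[of p q b] by (simp add: in_circle_of)
    ultimately show "q \<in> {0, 1} \<times> circle_of (d \<union> a) (snd p)" by (cases q) auto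
  qed
next
  let ?C = "circle_of (S b) p"
  have vert: "(0, k) \<in> ?C \<longleftrightarrow> (1, k) \<in> ?C" if "k \<in> V" for k
    by (rule circle_of_edge) (use that b in \<open>auto simp: stacked_def\<close>)
  have V: "u \<in> V" "v \<in> V" if "(u, v) \<in> a" for u v using that a(2) by (auto simp: Field_def)
  have "circle_of (d \<union> a) (snd p) \<subseteq> {k \<in> V. (0, k) \<in> ?C}"
  proof (rule circle_of_subset_closed)
    have "(0, snd p) \<in> ?C" using assms vert[of "snd p"] circle_of_self[of p] by (cases p) auto
    then show "snd p \<in> {k \<in> V. (0, k) \<in> ?C}" using assms by auto
    fix u v assume uv: "(u, v) \<in> d \<union> a"
    then have VV: "u \<in> V" "v \<in> V" using d(2) a(2) by (auto simp: Field_def)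
    have "((0, u), (0, v)) \<in> S b \<or> ((1, u), (1, v)) \<in> S b" using uv by (auto simp: stacked_def)
    then have "(0, u) \<in> ?C \<longleftrightarrow> (0, v) \<in> ?C"
      using circle_of_edge[of "(0, u)" "(0, v)" "S b" p] circle_of_edge[of "(1, u)" "(1, v)" "S b" p]
        vert[OF VV(1)] vert[OF VV(2)] by blast
    then show "u \<in> {k \<in> V. (0, k) \<in> ?C} \<longleftrightarrow> v \<in> {k \<in> V. (0, k) \<in> ?C}" using VV by simp
  qed
  then show "{0, 1} \<times> circle_of (d \<union> a) (snd p) \<subseteq> ?C" using vert by auto
qed

lemma circles_S_all: "circles (S b) = (\<times>) {0, 1} ` circles (d \<union> a)"
proof -
  have F: "Field (S b) = {0, 1} \<times> V" "Field (d \<union> a) = V" using Field_S[of b] d(2) a(2) by (auto simp: Field_Un)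
  show ?thesis
  proof (intro equalityI subsetI)
    fix C assume "C \<in> circles (S b)"
    then obtain p where p: "p \<in> {0, 1} \<times> V" "C = circle_of (S b) p" unfolding circles_def F by blast
    then have "circle_of (d \<union> a) (snd p) \<in> circles (d \<union> a)"
      using F(2) by (auto intro: circle_of_in_circles)
    then show "C \<in> (\<times>) {0, 1} ` circles (d \<union> a)"
      unfolding p(2) circle_of_S_all[OF p(1)] by (rule imageI)
  next
    fix C :: "point set" assume "C \<in> (\<times>) {0, 1} ` circles (d \<union> a)"
    then obtain k where "k \<in> V" "C = {0, 1} \<times> circle_of (d \<union> a) k" unfolding circles_def F by blast
    then have "C = circle_of (S b) (0, k)" using circle_of_S_all[of "(0, k)"] by simp
    moreover have "circle_of (S b) (0, k) \<in> circles (S b)"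
      using \<open>k \<in> V\<close> F(1) by (auto intro: circle_of_in_circles)
    ultimately show "C \<in> circles (S b)" by (rule ssubst)
  qed
qed

text \<open>Once all saddles are done, every component is a cylinder with one circle at each end.
  The condition [incoming \<open>X\<close>] + [outgoing \<open>1\<close>] = 1 then forces both
  labels to agree.\<close>

lemma compatible_all: "compatible b (\<lambda>Q. count_label (S b) AX l (UNIV \<times> Q)) = {straighten d a l}"
proof -
  have fin: "finite (d \<union> a)" using d a by simp
  have X: "count_label (S b) AX l (UNIV \<times> Q) = of_bool (l ({0, 1} \<times> Q) = AX)" if Q: "Q \<in> circles (d \<union> a)" for Q
  proof -
    have inj: "inj_on ((\<times>) ({0, 1} :: nat set)) (circles (d \<union> a))"
      by (rule inj_onI) (auto simp: times_eq_iff)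
    have "count_label (S b) AX l (UNIV \<times> Q)
        = (\<Sum>c\<in>circles (d \<union> a). of_bool (l ({0, 1} \<times> c) = AX \<and> c \<subseteq> Q))"
      unfolding count_label_def circles_S_all sum.reindex[OF inj] by (rule sum.cong) auto
    also have "\<dots> = count_label (d \<union> a) AX (\<lambda>c. l ({0, 1} \<times> c)) Q" by (simp add: count_label_def)
    finally show ?thesis using count_label_circle[OF fin Q] by simp
  qed
  have "compatible b (\<lambda>Q. count_label (S b) AX l (UNIV \<times> Q)) =
    {l' \<in> labellings (d \<union> a). \<forall>Q\<in>circles (d \<union> a). l' Q = l ({0, 1} \<times> Q)}"
    unfolding compatible_def
  proof (intro Collect_cong conj_cong refl)
    fix l' :: "nat labelling"
    have "of_bool (l ({0, 1} \<times> Q) = AX) + of_bool (l' Q = A1) = (1 :: nat) \<longleftrightarrow> l' Q = l ({0, 1} \<times> Q)" for Q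
      by (cases "l' Q"; cases "l ({0, 1} \<times> Q)") simp_all
    then show "(\<forall>Q\<in>circles (G b). count_label (S b) AX l (UNIV \<times> Q) + count_label (d \<union> a) A1 l' Q = 1)
        = (\<forall>Q\<in>circles (d \<union> a). l' Q = l ({0, 1} \<times> Q))"
      by (simp add: X count_label_circle[OF fin])
  qed
  also have "\<dots> = {straighten d a l}"
    unfolding straighten_def labellings_def by (auto simp: PiE_def extensional_def restrict_def fun_eq_iff)
  finally show ?thesis .
qed

context
  fixes T i j assumes T: "T \<subseteq> b" and ij: "(i, j) \<in> b - T"
begin

abbreviation (input) "T'' \<equiv> insert (i, j) T"

lemmas TV = ij_V[OF T ij] Field_S[OF T] Field_S[OF ij_V(4)[OF T ij]] finite_S[OF T] finite_S[OF ij_V(4)[OF T ij]]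

text \<open>Here \<open>F\<close> is the map of the remaining saddles. A merge leaves the components
  of the cobordism unchanged and preserves the number of labels \<open>X\<close> on each, unless
  both circles carry \<open>X\<close>. In that case the product is 0, and the component already has
  two incoming labels \<open>X\<close>, so no outgoing labelling is compatible.\<close>

lemma straighten_saddle_merge:
  assumes ne: "((0, i), (1, i)) \<notin> conn (S T)"
    and IH: "\<And>l. F l = sum frag_of (compatible T'' (\<lambda>Q. count_label (S T'') AX l (UNIV \<times> Q)))"
  shows "frag_extend F (F_saddle (S T) (S T'') (0, i) (1, i) (0, j) l) =
    sum frag_of (compatible T (\<lambda>Q. count_label (S T) AX l (UNIV \<times> Q)))"
proof -
  let ?c1 = "circle_of (S T) (0, i)" and ?c2 = "circle_of (S T) (1, i)" and ?c = "circle_of (S T'') (0, i)"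
  have ne': "?c1 \<noteq> ?c2" using ne by (simp add: circle_of_eq_iff)
  have F: "(0, i) \<in> Field (S T)" "(1, i) \<in> Field (S T)" using TV by auto
  have c12: "?c1 \<in> circles (S T)" "?c2 \<in> circles (S T)" using F by (auto intro: circle_of_in_circles)
  have FI: "Field (insert ((0, i), (1, i)) (S T)) = Field (S T'')" using F TV by (auto simp: Field_insert)
  have eq: "circle_of (S T'') = circle_of (insert ((0, i), (1, i)) (S T))"
    by (rule circle_of_conn_cong[OF conn_merge(2)[OF T ij ne]])
  have c: "?c = ?c1 \<union> ?c2" unfolding eq circle_of_insert[OF F] by simp
  have E': "circles (S T'') = insert (?c1 \<union> ?c2) (circles (S T) - {?c1, ?c2})"
    unfolding circles_insert[OF F, symmetric]
    by (rule circles_conn_cong[OF conn_merge(2)[OF T ij ne] FI[symmetric]])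
  \<comment> \<open>The merged circle runs through both ends of the arc, so removing the arc from
    \<open>G T\<close> disconnects nothing.\<close>
  have "(i, j) \<in> conn (G T'')" using conn_proj[OF conn_merge(1)[OF T ij ne]] by simp
  then have "conn (G T) = conn (G T'')"
    unfolding G_before[OF T ij] by (intro conn_eqI) (auto intro: conn_edge)
  then have GC: "circles (G T) = circles (G T'')" by (rule circles_conn_cong) (simp only: Field_G)
  have sub: "?c1 \<subseteq> UNIV \<times> Q \<longleftrightarrow> i \<in> Q" "?c2 \<subseteq> UNIV \<times> Q \<longleftrightarrow> i \<in> Q" if "Q \<in> circles (G T)" for Q
    using circle_subset_iff[OF c12(1) _ that, of "(0, i)"] circle_subset_iff[OF c12(2) _ that, of "(1, i)"] by auto
  have fin: "finite (circles (S T))" using TV finite_circles by blast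
  have step: "F (restrict (l(?c := z)) (circles (S T''))) =
      sum frag_of (compatible T (\<lambda>Q. count_label (S T) AX l (UNIV \<times> Q)))"
    if z: "of_bool (z = AX) = (of_bool (l ?c1 = AX) + of_bool (l ?c2 = AX) :: nat)" for z
  proof -
    have "count_label (S T'') AX (l(?c := z)) (UNIV \<times> Q) = count_label (S T) AX l (UNIV \<times> Q)"
      if Q: "Q \<in> circles (G T)" for Q
    proof (rule count_label_merge[OF fin c12 ne' E'])
      fix C assume "C \<in> circles (S T)" "C \<noteq> ?c1" "C \<noteq> ?c2"
      then have "C \<noteq> ?c" unfolding c using c12 circles_disjoint[of "?c1 \<union> ?c2" "S T" ?c1] circle_of_self by blast
      then show "(l(?c := z)) C = l C" by simp
    qed (use sub[OF Q] z c in auto)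
    then have "compatible T (\<lambda>Q. count_label (S T) AX l (UNIV \<times> Q)) =
        compatible T'' (\<lambda>Q. count_label (S T'') AX (l(?c := z)) (UNIV \<times> Q))"
      by (intro compatible_cong[OF GC]) (simp add: GC)
    then show ?thesis unfolding IH count_label_restrict[OF refl] by (rule arg_cong[OF sym])
  qed
  have L: "frag_extend F (F_saddle (S T) (S T'') (0, i) (1, i) (0, j) l) =
      frag_extend (\<lambda>z. F (restrict (l(?c := z)) (circles (S T'')))) (multA (l ?c1) (l ?c2))"
    unfolding F_saddle_def F_merge_def using ne' by (simp add: frag_extend_frag_extend)
  show ?thesis
  proof (cases "l ?c1 = AX \<and> l ?c2 = AX")
    case False
    then obtain z where "multA (l ?c1) (l ?c2) = frag_of z"
      "of_bool (z = AX) = (of_bool (l ?c1 = AX) + of_bool (l ?c2 = AX) :: nat)"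
      by (cases "l ?c1"; cases "l ?c2") auto
    then show ?thesis unfolding L using step by simp
  next
    case True
    let ?Q = "circle_of (G T) i"
    have "i \<in> Field (G T)" unfolding Field_G using ij_V(1)[OF T ij] .
    then have Q: "?Q \<in> circles (G T)" by (rule circle_of_in_circles)
    have "l ?c1 = AX \<and> ?c1 \<subseteq> UNIV \<times> ?Q" "l ?c2 = AX \<and> ?c2 \<subseteq> UNIV \<times> ?Q" using True sub[OF Q] circle_of_self by auto
    then have "2 \<le> count_label (S T) AX l (UNIV \<times> ?Q)"
      unfolding count_label_def sum_remove_two[OF fin c12 ne'] by (simp only: of_bool_eq le_add1 one_add_one simp_thms)
    then have "compatible T (\<lambda>Q. count_label (S T) AX l (UNIV \<times> Q)) = {}"
      unfolding compatible_def using Q by force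
    then show ?thesis unfolding L using True by simp
  qed
qed

text \<open>By \<open>gz\<close> the rest of the component falls into two pieces \<open>?Q1\<close>
  and \<open>?Q2\<close>, each with one of the new circles on its boundary. Let \<open>n1\<close>
  and \<open>n2\<close> be their counts without these circles. For the label \<open>X\<close> the
  condition \<open>n1 + n2 + 1 = 1\<close> means that both vanish, as \<open>X \<otimes> X\<close>
  requires. For the label \<open>1\<close> the condition \<open>n1 + n2 = 1\<close> has two
  exclusive cases, one for each term of the comultiplication of \<open>1\<close>.\<close>

lemma straighten_saddle_split:
  assumes eqc: "((0, i), (1, i)) \<in> conn (S T)" and gz: "(i, j) \<notin> conn (G T'')"
    and IH: "\<And>l. F l = sum frag_of (compatible T'' (\<lambda>Q. count_label (S T'') AX l (UNIV \<times> Q)))"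
  shows "frag_extend F (F_saddle (S T) (S T'') (0, i) (1, i) (0, j) l) =
    sum frag_of (compatible T (\<lambda>Q. count_label (S T) AX l (UNIV \<times> Q)))"
proof -
  let ?c1 = "circle_of (S T'') (0, i)" and ?c2 = "circle_of (S T'') (0, j)" and ?c = "circle_of (S T) (0, i)"
  let ?Q1 = "circle_of (G T'') i" and ?Q2 = "circle_of (G T'') j"
  have F: "(0, i) \<in> Field (S T'')" "(0, j) \<in> Field (S T'')" using TV by auto
  have c12: "?c1 \<in> circles (S T'')" "?c2 \<in> circles (S T'')" using F by (auto intro: circle_of_in_circles)
  have ne': "?c1 \<noteq> ?c2" using gz conn_proj[of "(0, i)" "(0, j)" T''] by (auto simp: circle_of_eq_iff)
  have FI: "Field (insert ((0, i), (0, j)) (S T'')) = Field (S T)" using F TV by (auto simp: Field_insert)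
  have c: "?c = ?c1 \<union> ?c2"
    unfolding circle_of_conn_cong[OF conn_split[OF T ij eqc]] circle_of_insert[OF F] by simp
  have E: "circles (S T) = insert (?c1 \<union> ?c2) (circles (S T'') - {?c1, ?c2})"
    unfolding circles_insert[OF F, symmetric]
    by (rule circles_conn_cong[OF conn_split[OF T ij eqc] FI[symmetric]])
  have ijF: "i \<in> Field (G T'')" "j \<in> Field (G T'')" unfolding Field_G using ij_V[OF T ij] by blast+
  have Q12: "?Q1 \<in> circles (G T'')" "?Q2 \<in> circles (G T'')" using ijF by (auto intro: circle_of_in_circles)
  have neQ: "?Q1 \<noteq> ?Q2" using gz by (simp add: circle_of_eq_iff)
  have disQ: "?Q1 \<inter> ?Q2 = {}" using circles_disjoint[OF Q12] neQ by blast
  have GC: "circles (G T) = insert (?Q1 \<union> ?Q2) (circles (G T'') - {?Q1, ?Q2})"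
    unfolding G_before[OF T ij] by (rule circles_insert[OF ijF])
  have sub: "?c1 \<subseteq> UNIV \<times> Q \<longleftrightarrow> Q = ?Q1" "?c2 \<subseteq> UNIV \<times> Q \<longleftrightarrow> Q = ?Q2" if "Q \<in> circles (G T'')" for Q
    using circle_subset_iff[OF c12(1) _ that, of "(0, i)"] circle_subset_iff[OF c12(2) _ that, of "(0, j)"]
    by (simp_all add: mem_circle_iff[OF that])
  have fin: "finite (circles (S T''))" using TV finite_circles by blast
  let ?R = "circles (S T'') - {?c1, ?c2}"
  have notin: "?c1 \<union> ?c2 \<notin> ?R"
    using c12 circles_disjoint[of "?c1 \<union> ?c2" "S T''" ?c1] circle_of_self by blast
  \<comment> \<open>\<open>r\<close> counts the circles labelled \<open>X\<close> away from the
    saddle and \<open>g\<close> the outgoing circles labelled \<open>1\<close>; both are additive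
    over the two pieces.\<close>
  define r where "r A = (\<Sum>c\<in>?R. of_bool (l c = AX \<and> c \<subseteq> UNIV \<times> A) :: nat)" for A :: "nat set"
  define g where "g l' A = count_label (d \<union> a) A1 l' A" for l' :: "nat labelling" and A :: "nat set"
  have r_Un: "r (?Q1 \<union> ?Q2) = r ?Q1 + r ?Q2"
  proof -
    have "(of_bool (l C = AX \<and> C \<subseteq> UNIV \<times> (?Q1 \<union> ?Q2)) :: nat)
        = of_bool (l C = AX \<and> C \<subseteq> UNIV \<times> ?Q1) + of_bool (l C = AX \<and> C \<subseteq> UNIV \<times> ?Q2)"
      if "C \<in> ?R" for C
    proof -
      have C: "C \<in> circles (S T'')" using that by simp
      then obtain p where p: "p \<in> C" using circles_nonempty by blast
      have "C \<subseteq> UNIV \<times> ?Q1 \<longleftrightarrow> snd p \<in> ?Q1" "C \<subseteq> UNIV \<times> ?Q2 \<longleftrightarrow> snd p \<in> ?Q2"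
        using circle_subset_iff[OF C p] Q12 by auto
      moreover have "C \<subseteq> UNIV \<times> (?Q1 \<union> ?Q2) \<longleftrightarrow> snd p \<in> ?Q1 \<or> snd p \<in> ?Q2"
        using calculation p by auto
      ultimately show ?thesis using disQ by auto
    qed
    then show ?thesis unfolding r_def by (simp add: sum.distrib)
  qed
  have g_Un: "g l' (?Q1 \<union> ?Q2) = g l' ?Q1 + g l' ?Q2" for l'
    unfolding g_def
  proof (rule count_label_Un[OF _ disQ])
    show "finite (d \<union> a)" using d a by simp
    fix C assume C: "C \<in> circles (d \<union> a)" "C \<subseteq> ?Q1 \<union> ?Q2"
    then obtain k where k: "k \<in> C" using circles_nonempty by blast
    have "C \<subseteq> circle_of (G T'') k" by (rule circle_subset_circle_of[OF k C(1)]) (auto intro: conn_edge)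
    moreover have "circle_of (G T'') k = ?Q1 \<or> circle_of (G T'') k = ?Q2"
      using k C(2) circlesD[OF Q12(1), of k] circlesD[OF Q12(2), of k] by blast
    ultimately show "C \<subseteq> ?Q1 \<or> C \<subseteq> ?Q2" by auto
  qed
  have cnt: "count_label (S T'') AX (l(?c1 := y, ?c2 := z)) (UNIV \<times> Q)
      = r Q + of_bool (y = AX \<and> Q = ?Q1) + of_bool (z = AX \<and> Q = ?Q2)"
    if Q: "Q \<in> circles (G T'')" for y z Q
  proof -
    let ?l = "l(?c1 := y, ?c2 := z)"
    have "count_label (S T'') AX ?l (UNIV \<times> Q) = of_bool (?l ?c1 = AX \<and> ?c1 \<subseteq> UNIV \<times> Q)
        + of_bool (?l ?c2 = AX \<and> ?c2 \<subseteq> UNIV \<times> Q) + (\<Sum>C\<in>?R. of_bool (?l C = AX \<and> C \<subseteq> UNIV \<times> Q))"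
      unfolding count_label_def by (rule sum_remove_two[OF fin c12 ne'])
    moreover have "(\<Sum>C\<in>?R. of_bool (?l C = AX \<and> C \<subseteq> UNIV \<times> Q)) = r Q"
      unfolding r_def by (rule sum.cong) auto
    moreover have "?l ?c1 = y" "?l ?c2 = z" using ne' by auto
    ultimately show ?thesis by (simp only: sub[OF Q] ac_simps)
  qed
  have cntT: "count_label (S T) AX l (UNIV \<times> Q) = r Q + of_bool (l ?c = AX \<and> Q = ?Q1 \<union> ?Q2)"
    if Q: "Q \<in> circles (G T)" for Q
  proof -
    have cT: "?c \<in> circles (S T)" using TV by (auto intro: circle_of_in_circles)
    have 1: "?Q1 \<union> ?Q2 = circle_of (G T) i"
      unfolding G_before[OF T ij] circle_of_insert[OF ijF] by simp
    have "?c \<subseteq> UNIV \<times> Q \<longleftrightarrow> Q = ?Q1 \<union> ?Q2"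
      using circle_subset_iff[OF cT _ Q, of "(0, i)"] mem_circle_iff[OF Q, of i] unfolding 1 by simp
    moreover have "count_label (S T) AX l (UNIV \<times> Q) = of_bool (l ?c = AX \<and> ?c \<subseteq> UNIV \<times> Q) + r Q"
      unfolding count_label_def E r_def c by (rule sum.insert) (use notin fin in auto)
    ultimately show ?thesis by (simp only: ac_simps)
  qed
  let ?P = "\<lambda>f l'. l' \<in> labellings (d \<union> a) \<and> (\<forall>Q\<in>circles (G T'') - {?Q1, ?Q2}. r Q + g l' Q = 1) \<and> f l'"
  have compT: "compatible T (\<lambda>Q. count_label (S T) AX l (UNIV \<times> Q)) =
    {l'. ?P (\<lambda>l'. r ?Q1 + r ?Q2 + of_bool (l ?c = AX) + g l' ?Q1 + g l' ?Q2 = 1) l'}"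
  proof -
    have nQ: "?Q1 \<union> ?Q2 \<notin> circles (G T'') - {?Q1, ?Q2}"
      using Q12 circles_disjoint[of "?Q1 \<union> ?Q2" "G T''" ?Q1] circle_of_self by blast
    have "(\<forall>Q\<in>circles (G T). count_label (S T) AX l (UNIV \<times> Q) + count_label (d \<union> a) A1 l' Q = 1) \<longleftrightarrow>
      (\<forall>Q\<in>circles (G T). r Q + of_bool (l ?c = AX \<and> Q = ?Q1 \<union> ?Q2) + g l' Q = 1)" for l'
      using cntT g_def by auto
    moreover have "\<dots> l' \<longleftrightarrow> (\<forall>Q\<in>circles (G T'') - {?Q1, ?Q2}. r Q + g l' Q = 1) \<and>
        r ?Q1 + r ?Q2 + of_bool (l ?c = AX) + g l' ?Q1 + g l' ?Q2 = 1" for l'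
    proof -
      have "(\<forall>Q\<in>circles (G T'') - {?Q1, ?Q2}. r Q + of_bool (l ?c = AX \<and> Q = ?Q1 \<union> ?Q2) + g l' Q = 1)
          = (\<forall>Q\<in>circles (G T'') - {?Q1, ?Q2}. r Q + g l' Q = 1)"
        using nQ by (intro ball_cong refl) auto
      then show ?thesis unfolding GC using r_Un g_Un by (auto simp: algebra_simps)
    qed
    ultimately show ?thesis unfolding compatible_def by auto
  qed
  have compT': "compatible T'' (\<lambda>Q. count_label (S T'') AX (l(?c1 := y, ?c2 := z)) (UNIV \<times> Q)) =
    {l'. ?P (\<lambda>l'. r ?Q1 + of_bool (y = AX) + g l' ?Q1 = 1 \<and> r ?Q2 + of_bool (z = AX) + g l' ?Q2 = 1) l'}" for y z
  proof -
    have GG: "circles (G T'') = insert ?Q1 (insert ?Q2 (circles (G T'') - {?Q1, ?Q2}))" using Q12 by auto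
    have "(\<forall>Q\<in>circles (G T''). count_label (S T'') AX (l(?c1 := y, ?c2 := z)) (UNIV \<times> Q) + count_label (d \<union> a) A1 l' Q = 1)
      \<longleftrightarrow> (\<forall>Q\<in>circles (G T''). r Q + of_bool (y = AX \<and> Q = ?Q1) + of_bool (z = AX \<and> Q = ?Q2) + g l' Q = 1)" for l'
      using cnt g_def by simp
    moreover have "(\<forall>Q\<in>circles (G T''). r Q + of_bool (y = AX \<and> Q = ?Q1) + of_bool (z = AX \<and> Q = ?Q2) + g l' Q = 1)
      \<longleftrightarrow> (\<forall>Q\<in>circles (G T'') - {?Q1, ?Q2}. r Q + g l' Q = 1) \<and>
          r ?Q1 + of_bool (y = AX) + g l' ?Q1 = 1 \<and> r ?Q2 + of_bool (z = AX) + g l' ?Q2 = 1" for l'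
      by (subst GG) (use neQ in auto)
    ultimately show ?thesis unfolding compatible_def by auto
  qed
  have L: "frag_extend F (F_saddle (S T) (S T'') (0, i) (1, i) (0, j) l) =
      frag_extend (\<lambda>(y, z). sum frag_of (compatible T'' (\<lambda>Q. count_label (S T'') AX (l(?c1 := y, ?c2 := z)) (UNIV \<times> Q))))
        (comultA (l ?c))"
    unfolding F_saddle_def F_split_def using eqc
    by (simp add: frag_extend_frag_extend circle_of_eq_iff case_prod_unfold IH count_label_restrict)
  show ?thesis
  proof (cases "l ?c")
    case AX
    then show ?thesis unfolding L compT' compT by (auto intro!: arg_cong[where f = "sum frag_of"])
  next
    case A1
    let ?A = "\<lambda>y z. {l'. ?P (\<lambda>l'. r ?Q1 + of_bool (y = AX) + g l' ?Q1 = 1 \<and> r ?Q2 + of_bool (z = AX) + g l' ?Q2 = 1) l'}"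
    have fin: "finite (?A y z)" for y z unfolding compT'[symmetric] by (rule finite_compatible)
    have "?A A1 AX \<inter> ?A AX A1 = {}" by auto
    moreover have "?A A1 AX \<union> ?A AX A1 = {l'. ?P (\<lambda>l'. r ?Q1 + r ?Q2 + of_bool (l ?c = AX) + g l' ?Q1 + g l' ?Q2 = 1) l'}"
      using A1 by auto
    ultimately show ?thesis unfolding L compT' compT
      using sum.union_disjoint[OF fin fin, of A1 AX AX A1 frag_of] A1 by (simp add: frag_extend_add)
  qed
qed

end

text \<open>The hypothesis says that a splitting saddle separates the rest of its component of the
  cobordism, so that all components have genus 0.\<close>

lemma straighten_F_saddles:
  assumes gz: "\<And>T i j. T \<subseteq> b \<Longrightarrow> (i, j) \<in> b - T \<Longrightarrow> ((0, i), (1, i)) \<in> conn (S T) \<Longrightarrow>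
      (i, j) \<notin> conn (G (insert (i, j) T))"
  assumes "T \<subseteq> b" "distinct es" "set es = b - T"
  shows "frag_extend (\<lambda>l. frag_of (straighten d a l)) (F_saddles d b T a es l) =
    sum frag_of (compatible T (\<lambda>Q. count_label (S T) AX l (UNIV \<times> Q)))"
  using assms(2-)
proof (induction es arbitrary: T l)
  case Nil
  then have "T = b" by auto
  then show ?case by (simp add: compatible_all)
next
  case (Cons e es)
  obtain i j where e: "e = (i, j)" by (cases e)
  have ij: "(i, j) \<in> b - T" using Cons.prems e by auto
  define F where "F = (\<lambda>l. frag_extend (\<lambda>l. frag_of (straighten d a l)) (F_saddles d b (insert (i, j) T) a es l))"
  have IH: "F l = sum frag_of (compatible (insert (i, j) T) (\<lambda>Q. count_label (S (insert (i, j) T)) AX l (UNIV \<times> Q)))" for l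
    unfolding F_def by (rule Cons.IH) (use Cons.prems e in auto)
  have "frag_extend (\<lambda>l. frag_of (straighten d a l)) (F_saddles d b T a (e # es) l) =
      frag_extend F (F_saddle (S T) (S (insert (i, j) T)) (0, i) (1, i) (0, j) l)"
    unfolding F_def e by (simp add: frag_extend_frag_extend)
  also have "\<dots> = sum frag_of (compatible T (\<lambda>Q. count_label (S T) AX l (UNIV \<times> Q)))"
    using straighten_saddle_merge[OF Cons.prems(1) ij _ IH] straighten_saddle_split[OF Cons.prems(1) ij _ _ IH]
      gz[OF Cons.prems(1) ij] by blast
  finally show ?case .
qed

end

section \<open>Products in the arc ring\<close>

lemma (in linorder) set_distinct_sorted_key_list_of_set:
  assumes "inj_on f A" "finite A"
  shows "set (sorted_key_list_of_set f A) = A" "distinct (sorted_key_list_of_set f A)"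
proof -
  interpret folding_insort_key "(\<le>)" "(<)" A f by unfold_locales (rule assms(1))
  show "set (sorted_key_list_of_set f A) = A" using assms(2) by simp
  show "distinct (sorted_key_list_of_set f A)"
    using distinct_sorted_key_list_of_set[of A] by (simp add: distinct_map)
qed

context stack
begin

lemma circle_of_S_empty:
  "circle_of (S {}) (0, k) = {0} \<times> circle_of (d \<union> b) k"
  "circle_of (S {}) (1, k) = {1} \<times> circle_of (b \<union> a) k"
proof -
  have *: "circle_of (S {}) (r, k) = {r} \<times> circle_of E k"
    if E: "\<And>u v s. ((s, u), (r, v)) \<in> S {} \<or> ((r, u), (s, v)) \<in> S {} \<Longrightarrow> s = r \<and> (u, v) \<in> E"
      "\<And>u v. (u, v) \<in> E \<Longrightarrow> ((r, u), (r, v)) \<in> S {}" for r and E :: "(nat \<times> nat) set"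
  proof
    show "circle_of (S {}) (r, k) \<subseteq> {r} \<times> circle_of E k"
    proof (rule circle_of_subset_closed)
      fix x y assume xy: "(x, y) \<in> S {}"
      obtain s u s' v where [simp]: "x = (s, u)" "y = (s', v)" by (cases x, cases y)
      show "x \<in> {r} \<times> circle_of E k \<longleftrightarrow> y \<in> {r} \<times> circle_of E k"
      proof (cases "s = r \<or> s' = r")
        case True
        then have "s = r" "s' = r" "(u, v) \<in> E" using E(1)[of s u v] E(1)[of s' u v] xy by auto
        then show ?thesis using circle_of_edge[of u v E k] by simp
      qed simp
    qed simp
    have "circle_of E k \<subseteq> {u. (r, u) \<in> circle_of (S {}) (r, k)}"
    proof (rule circle_of_subset_closed)
      fix u v assume "(u, v) \<in> E"
      from circle_of_edge[OF E(2)[OF this]] show "u \<in> {u. (r, u) \<in> circle_of (S {}) (r, k)} \<longleftrightarrow>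
          v \<in> {u. (r, u) \<in> circle_of (S {}) (r, k)}" by blast
    qed simp
    then show "{r} \<times> circle_of E k \<subseteq> circle_of (S {}) (r, k)" by auto
  qed
  show "circle_of (S {}) (0, k) = {0} \<times> circle_of (d \<union> b) k"
    by (rule *) (auto simp: stacked_def)
  show "circle_of (S {}) (1, k) = {1} \<times> circle_of (b \<union> a) k"
    by (rule *) (auto simp: stacked_def)
qed

lemma circles_S_empty:
  "circles (S {}) = (\<times>) {0} ` circles (d \<union> b) \<union> (\<times>) {1} ` circles (b \<union> a)"
proof -
  have F: "Field (S {}) = Pair 0 ` V \<union> Pair 1 ` V" "Field (d \<union> b) = V" "Field (b \<union> a) = V"
    using Field_S[of "{}"] d(2) a(2) b(2) by (auto simp: Field_Un)
  show ?thesis unfolding circles_def F image_Un image_image circle_of_S_empty ..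
qed

lemma count_label_juxtapose:
  "count_label (S {}) AX (juxtapose d b a l1 l2) (UNIV \<times> Q) =
    count_label (d \<union> b) AX l1 Q + count_label (b \<union> a) AX l2 Q"
proof -
  let ?l = "\<lambda>C :: point set. if C \<subseteq> {0} \<times> UNIV then l1 (snd ` C) else l2 (snd ` C)"
  have inj: "inj_on ((\<times>) {r}) X" for r :: nat and X :: "nat set set"
    by (rule inj_onI) (auto simp: times_eq_iff)
  have fin: "finite (circles (d \<union> b))" "finite (circles (b \<union> a))"
    using d b a by (auto intro: finite_circles)
  have dis: "(\<times>) {0} ` circles (d \<union> b) \<inter> (\<times>) {1 :: nat} ` circles (b \<union> a) = {}"
    using circles_nonempty[of _ "d \<union> b"] by (fastforce simp: times_eq_iff)
  have "count_label (S {}) AX (juxtapose d b a l1 l2) (UNIV \<times> Q) =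
      (\<Sum>C\<in>circles (S {}). of_bool (?l C = AX \<and> C \<subseteq> UNIV \<times> Q))"
    unfolding juxtapose_def count_label_restrict[OF refl] by (simp add: count_label_def)
  also have "\<dots> = (\<Sum>c\<in>circles (d \<union> b). of_bool (?l ({0} \<times> c) = AX \<and> {0 :: nat} \<times> c \<subseteq> UNIV \<times> Q))
      + (\<Sum>c\<in>circles (b \<union> a). of_bool (?l ({1} \<times> c) = AX \<and> {1 :: nat} \<times> c \<subseteq> UNIV \<times> Q))"
    unfolding circles_S_empty using fin dis
    by (subst sum.union_disjoint) (simp_all add: sum.reindex[OF inj] del: sum_of_bool_eq One_nat_def)
  also have "(\<Sum>c\<in>circles (d \<union> b). of_bool (?l ({0} \<times> c) = AX \<and> {0 :: nat} \<times> c \<subseteq> UNIV \<times> Q)) =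
      count_label (d \<union> b) AX l1 Q"
    unfolding count_label_def by (rule sum.cong) (auto simp: snd_image_times)
  also have "(\<Sum>c\<in>circles (b \<union> a). of_bool (?l ({1} \<times> c) = AX \<and> {1 :: nat} \<times> c \<subseteq> UNIV \<times> Q)) =
      count_label (b \<union> a) AX l2 Q"
    unfolding count_label_def
  proof (rule sum.cong)
    fix c assume "c \<in> circles (b \<union> a)"
    then have "c \<noteq> {}" by (rule circles_nonempty)
    then have "\<not> {1 :: nat} \<times> c \<subseteq> {0} \<times> UNIV" "snd ` ({1 :: nat} \<times> c) = c" "{1 :: nat} \<times> c \<subseteq> UNIV \<times> Q \<longleftrightarrow> c \<subseteq> Q"
      by (auto simp: snd_image_times)
    then show "(of_bool (?l ({1} \<times> c) = AX \<and> {1 :: nat} \<times> c \<subseteq> UNIV \<times> Q) :: nat) = of_bool (l2 c = AX \<and> c \<subseteq> Q)"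
      by simp
  qed simp
  finally show ?thesis .
qed

text \<open>At \<open>T = {}\<close> the components of the whole cobordism are those of
  \<open>d \<union> a \<union> b\<close>. The resulting formula no longer depends on the order of
  the saddles.\<close>

lemma F_min_cobordism_eq:
  assumes gz: "\<And>T i j. T \<subseteq> b \<Longrightarrow> (i, j) \<in> b - T \<Longrightarrow> ((0, i), (1, i)) \<in> conn (S T) \<Longrightarrow>
      (i, j) \<notin> conn (G (insert (i, j) T))"
  shows "F_min_cobordism d b a l1 l2 =
    sum frag_of {l \<in> labellings (d \<union> a). \<forall>Q\<in>circles (d \<union> a \<union> b).
      count_label (d \<union> b) AX l1 Q + count_label (b \<union> a) AX l2 Q + count_label (d \<union> a) A1 l Q = 1}"
proof -
  \<comment> \<open>An arc of a matching is determined by its left endpoint, so sorting by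
    \<open>fst\<close> lists every arc once.\<close>
  have "inj_on fst b" by (rule inj_onI) (use b(1) pmatchD in \<open>fastforce simp: prod_eq_iff\<close>)
  from set_distinct_sorted_key_list_of_set[OF this b(3)]
  have "set (sorted_key_list_of_set fst b) = b" "distinct (sorted_key_list_of_set fst b)" .
  then show ?thesis
    unfolding F_min_cobordism_def
    using straighten_F_saddles[OF gz, of "{}" "sorted_key_list_of_set fst b" "juxtapose d b a l1 l2"]
    by (simp add: compatible_def count_label_juxtapose)
qed

text \<open>If the rows are already connected at \<open>i\<close>, there is a vertical line over
  some \<open>t\<close> in the component of \<open>i\<close>. If \<open>i\<close> and
  \<open>j\<close> also stayed connected without the arc, then \<open>i\<close>, \<open>j\<close>,
  \<open>t\<close> would be three points of one component of
  \<open>a \<union> (b - insert (i, j) T)\<close>, all missed by the second matching, and a path has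
  only two ends.\<close>

lemma genus_zero_same_outer:
  assumes "d = a" and T: "T \<subseteq> b" and ij: "(i, j) \<in> b - T" and eq: "((0, i), (1, i)) \<in> conn (S T)"
  shows "(i, j) \<notin> conn (G (insert (i, j) T))"
proof
  assume con: "(i, j) \<in> conn (G (insert (i, j) T))"
  \<comment> \<open>Only a vertical line changes the row, so without one over this component the
    circle of \<open>(0, i)\<close> would stay in row 0.\<close>
  have "\<exists>t\<in>Field T. (i, t) \<in> conn (G T)"
  proof (rule ccontr)
    assume no: "\<not> ?thesis"
    have "circle_of (S T) (0, i) \<subseteq> {0} \<times> circle_of (G T) i"
    proof (rule circle_of_subset_closed)
      fix x y assume xy: "(x, y) \<in> S T"
      obtain s u s' v where [simp]: "x = (s, u)" "y = (s', v)" by (cases x, cases y)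
      have "s' = s \<and> (u, v) \<in> G T \<or> u = v \<and> u \<in> Field T"
        using xy assms(1) by (auto simp: stacked_def)
      then show "x \<in> {0} \<times> circle_of (G T) i \<longleftrightarrow> y \<in> {0} \<times> circle_of (G T) i"
      proof
        assume "s' = s \<and> (u, v) \<in> G T"
        then show ?thesis using circle_of_edge[of u v "G T" i] by simp
      next
        assume "u = v \<and> u \<in> Field T"
        then have "u = v" "u \<notin> circle_of (G T) i" using no by (auto simp: in_circle_of)
        then show ?thesis by simp
      qed
    qed simp
    then show False using eq by (auto simp: in_circle_of[symmetric])
  qed
  then obtain t where t: "t \<in> Field T" "(i, t) \<in> conn (G T)" by blast
  let ?T = "insert (i, j) T"
  have "conn (G T) = conn (G ?T)"
    unfolding G_before[OF T ij] by (rule conn_eqI) (use con in \<open>auto intro: conn_edge\<close>)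
  then have c: "t \<in> circle_of (a \<union> (b - ?T)) i" "j \<in> circle_of (a \<union> (b - ?T)) i"
    using t con assms(1) by (auto simp: in_circle_of)
  have F: "Field (b - ?T) = V - insert i (insert j (Field T))"
    using pmatch_Field_Diff[OF b(1) ij_V(4)[OF T ij]] b(2) by (auto simp: Field_insert)
  have "i = t \<or> i = j \<or> t = j"
    by (rule two_unmatched_points[OF a(1) _ _ _ _ c]) (use b(1) t F in \<open>auto intro: pmatch_subset\<close>)
  then show False using t ij_notin_Field[OF T ij] ij_V(3)[OF T ij] by blast
qed

text \<open>In row 0 the arc is doubled and forms a circle by itself. Hence every saddle is a merge,
  and the genus condition holds vacuously.\<close>

lemma genus_zero_same_left:
  assumes "d = b" and T: "T \<subseteq> b" and ij: "(i, j) \<in> b - T"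
  shows "((0, i), (1, i)) \<notin> conn (S T)"
proof -
  have ij': "(i, j) \<in> b" using ij by simp
  have "circle_of (S T) (0, i) \<subseteq> {0} \<times> {i, j}"
  proof (rule circle_of_subset_closed)
    fix x y assume xy: "(x, y) \<in> S T"
    obtain s u s' v where [simp]: "x = (s, u)" "y = (s', v)" by (cases x, cases y)
    have "s' = 0 \<and> s = 0 \<and> (u, v) \<in> b \<or> s' = 1 \<and> s = 1 \<or> u = v \<and> u \<in> Field T"
      using xy assms(1) by (auto simp: stacked_def)
    then consider "s' = 0" "s = 0" "(u, v) \<in> b" | "s' = 1" "s = 1" | "u = v" "u \<in> Field T" by blast
    then show "x \<in> {0} \<times> {i, j} \<longleftrightarrow> y \<in> {0} \<times> {i, j}"
    proof cases
      case 1
      have "u \<in> {i, j} \<longleftrightarrow> v \<in> {i, j}" using pmatchD[OF b(1) 1(3) ij'] by blast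
      then show ?thesis using 1 by simp
    next
      case 3
      then have "u \<noteq> i" "u \<noteq> j" using ij_notin_Field[OF T ij] by auto
      then show ?thesis using 3(1) by simp
    qed auto
  qed simp
  then show ?thesis by (auto simp: in_circle_of[symmetric])
qed

end

lemma stackI:
  assumes "d \<in> crossingless_matchings n" "b \<in> crossingless_matchings n" "a \<in> crossingless_matchings n"
  shows "stack {1..2 * n} d b a"
  using assms by unfold_locales (auto simp: crossingless_matchingsD)

text \<open>The components of the cobordism are the circles of \<open>a \<union> b\<close>, and each
  has one incoming circle from either factor. The counts of \<open>X\<close> therefore become two
  truth values.\<close>

lemma mult_opposite:
  assumes a: "a \<in> crossingless_matchings n" and b: "b \<in> crossingless_matchings n"
  shows "arc_basis_mult (a, b, l1) (b, a, l2) =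
    (\<Sum>l\<in>{l \<in> labellings a. \<forall>Q\<in>circles (a \<union> b).
      of_bool (l1 Q = AX) + of_bool (l2 Q = AX) + count_label a A1 l Q = 1}. frag_of (a, a, l))"
proof -
  interpret stack "{1..2 * n}" a b a by (rule stackI[OF a b a])
  have fin: "finite a" "finite b" using a b by (auto dest: crossingless_matchingsD)
  have "F_min_cobordism a b a l1 l2 = sum frag_of {l \<in> labellings a. \<forall>Q\<in>circles (a \<union> b).
      of_bool (l1 Q = AX) + of_bool (l2 Q = AX) + count_label a A1 l Q = 1}"
  proof -
    have "F_min_cobordism a b a l1 l2 = sum frag_of {l \<in> labellings (a \<union> a). \<forall>Q\<in>circles (a \<union> a \<union> b).
        count_label (a \<union> b) AX l1 Q + count_label (b \<union> a) AX l2 Q + count_label (a \<union> a) A1 l Q = 1}"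
      by (rule F_min_cobordism_eq, rule genus_zero_same_outer) auto
    moreover have "count_label (a \<union> b) AX l Q = of_bool (l Q = AX)" if "Q \<in> circles (a \<union> b)" for l Q
      by (rule count_label_circle) (use fin that in auto)
    ultimately show ?thesis unfolding Un_absorb Un_commute[of b a] by (simp only: cong: ball_cong)
  qed
  moreover have "finite {l \<in> labellings a. \<forall>Q\<in>circles (a \<union> b).
      of_bool (l1 Q = AX) + of_bool (l2 Q = AX) + count_label a A1 l Q = 1}"
    using finite_labellings[OF fin(1)] by simp
  ultimately show ?thesis by (simp add: frag_extend_sum)
qed

text \<open>Since \<open>b \<union> a \<union> b = b \<union> a\<close>, each component has one
  circle of the second factor and one outgoing circle, while the first factor contributes no
  \<open>X\<close>. The count then forces the two labels to agree.\<close>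

lemma mult_unit_left:
  assumes a: "a \<in> crossingless_matchings n" and b: "b \<in> crossingless_matchings n"
    and l: "l \<in> labellings (b \<union> a)"
  shows "arc_basis_mult (b, b, restrict (\<lambda>_. A1) (circles b)) (b, a, l) = frag_of (b, a, l)"
proof -
  interpret stack "{1..2 * n}" b b a by (rule stackI[OF b b a])
  have fin: "finite (b \<union> a)" using a b by (auto dest: crossingless_matchingsD)
  have U: "b \<union> b = b" "b \<union> a \<union> b = b \<union> a" by auto
  have "count_label b AX (restrict (\<lambda>_. A1) (circles b)) Q = 0" for Q
    unfolding count_label_restrict[OF refl] by (simp add: count_label_def)
  moreover have "of_bool (l Q = AX) + of_bool (l' Q = A1) = (1 :: nat) \<longleftrightarrow> l' Q = l Q" for l' :: "nat labelling" and Q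
    by (cases "l' Q"; cases "l Q") simp_all
  ultimately have "{l' \<in> labellings (b \<union> a). \<forall>Q\<in>circles (b \<union> a \<union> b).
      count_label (b \<union> b) AX (restrict (\<lambda>_. A1) (circles b)) Q + count_label (b \<union> a) AX l Q + count_label (b \<union> a) A1 l' Q = 1}
     = {l' \<in> labellings (b \<union> a). \<forall>Q\<in>circles (b \<union> a). l' Q = l Q}"
    unfolding U using count_label_circle[OF fin] by auto
  also have "\<dots> = {l}" using l unfolding labellings_def by (auto intro: PiE_ext)
  finally have "F_min_cobordism b b a (restrict (\<lambda>_. A1) (circles b)) l = frag_of l"
    using F_min_cobordism_eq[of "restrict (\<lambda>_. A1) (circles b)" l] genus_zero_same_left[OF refl]
    by (simp add: Un_absorb del: Un_iff)
  then show ?thesis by simp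
qed

section \<open>Surgery on crossingless matchings\<close>

lemma crossingless_matchingsI:
  assumes "pmatch m" "Field m = {1..2 * n}" "\<And>i j. (i, j) \<in> m \<Longrightarrow> i < j"
    and "\<And>i j k l. (i, k) \<in> m \<Longrightarrow> (j, l) \<in> m \<Longrightarrow> i < j \<Longrightarrow> j < k \<Longrightarrow> k < l \<Longrightarrow> False"
  shows "m \<in> crossingless_matchings n"
proof -
  have "m \<subseteq> {(i, j). 1 \<le> i \<and> i < j \<and> j \<le> 2 * n}"
  proof
    fix e assume "e \<in> m"
    moreover obtain i j where "e = (i, j)" by (cases e)
    ultimately show "e \<in> {(i, j). 1 \<le> i \<and> i < j \<and> j \<le> 2 * n}"
      using assms(3)[of i j] FieldI1[of i j m] FieldI2[of i j m] unfolding assms(2) by simp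
  qed
  moreover have "\<exists>!e. e \<in> m \<and> (k = fst e \<or> k = snd e)" if "k \<in> {1..2 * n}" for k
  proof -
    obtain y where "(k, y) \<in> m \<or> (y, k) \<in> m" using \<open>k \<in> {1..2 * n}\<close> unfolding assms(2)[symmetric] Field_iff ..
    then have "\<exists>e. e \<in> m \<and> (k = fst e \<or> k = snd e)" by force
    moreover have "e = e'" if "e \<in> m \<and> (k = fst e \<or> k = snd e)" "e' \<in> m \<and> (k = fst e' \<or> k = snd e')" for e e'
      using assms(1) that unfolding pmatch_def by blast
    ultimately show ?thesis by blast
  qed
  ultimately show ?thesis unfolding crossingless_matchings_def by (blast dest: assms(4))
qed

lemma crossingless_matchings_less: "m \<in> crossingless_matchings n \<Longrightarrow> (i, j) \<in> m \<Longrightarrow> i < j"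
  unfolding crossingless_matchings_def by blast

lemma crossingless_matchings_noncrossing:
  "m \<in> crossingless_matchings n \<Longrightarrow> (i, k) \<in> m \<Longrightarrow> (j, l) \<in> m \<Longrightarrow> i < j \<Longrightarrow> j < k \<Longrightarrow> k < l \<Longrightarrow> False"
  unfolding crossingless_matchings_def by blast

lemma arcs_disjoint:
  assumes "pmatch m" "(x, y) \<in> m" "(k, l) \<in> m" "(x, y) \<noteq> (k, l)"
  shows "x \<noteq> k" "x \<noteq> l" "y \<noteq> k" "y \<noteq> l"
  using pmatchD[OF assms(1,2,3)] assms(4) by blast+

text \<open>An inequality of truth values says that a point lies between \<open>x\<close> and
  \<open>y\<close>, whichever is larger, and such statements can be added modulo 2. This is the form
  used in \<open>closer_matching\<close>.\<close>

lemma noncrossing_not_separating: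
  assumes m: "m \<in> crossingless_matchings n" and "(x, y) \<in> m" "(k, l) \<in> m" "(x, y) \<noteq> (k, l)"
  shows "(x < k) \<noteq> (y < k) \<longleftrightarrow> (x < l) \<noteq> (y < l)"
proof -
  note nc = crossingless_matchings_noncrossing[OF m assms(2,3)]
    crossingless_matchings_noncrossing[OF m assms(3,2)]
  note less = crossingless_matchings_less[OF m assms(2)] crossingless_matchings_less[OF m assms(3)]
  note ne = arcs_disjoint[OF crossingless_matchingsD(1)[OF m] assms(2-4)]
  show ?thesis using nc less ne by (meson less_trans linorder_less_linear)
qed

lemma pmatch_insert:
  assumes "pmatch E" "x \<noteq> y" "x \<notin> Field E" "y \<notin> Field E"
  shows "pmatch (insert (x, y) E)"
proof (rule pmatchI)
  show "u \<noteq> v" if "(u, v) \<in> insert (x, y) E" for u v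
    using that assms(2) pmatch_irrefl[OF assms(1)] by auto
  show "u = u' \<and> v = v'" if uv: "(u, v) \<in> insert (x, y) E" "(u', v') \<in> insert (x, y) E"
    and eq: "u = u' \<or> u = v' \<or> v = u' \<or> v = v'" for u v u' v'
  proof (cases "(u, v) \<in> E \<and> (u', v') \<in> E")
    case True then show ?thesis using pmatchD[OF assms(1) _ _ eq] by blast
  next
    case False
    have F: "s \<noteq> x" "s \<noteq> y" "t \<noteq> x" "t \<noteq> y" if "(s, t) \<in> E" for s t
      using that assms(3,4) FieldI1[of s t E] FieldI2[of s t E] by blast+
    show ?thesis using False uv eq F[of u v] F[of u' v'] assms(2) by blast
  qed
qed

text \<open>Surgery creates a shortest arc \<open>(i, j)\<close> of \<open>b - a\<close>: the points strictly between \<open>i\<close> and \<open>j\<close> are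
  matched among themselves by arcs common to \<open>a\<close> and \<open>b\<close>.\<close>

lemma closer_matching:
  assumes a: "a \<in> crossingless_matchings n" and b: "b \<in> crossingless_matchings n" and ne: "\<not> b \<subseteq> a"
  obtains a' r w x y z where "w < x" "x < y" "y < z"
    "a = r \<union> {(w, x), (y, z)} \<and> a' = r \<union> {(w, z), (x, y)} \<or>
     a' = r \<union> {(w, x), (y, z)} \<and> a = r \<union> {(w, z), (x, y)}"
    "a' \<in> crossingless_matchings n" "card (b - a') < card (b - a)"
    "{w, x, y, z} \<subseteq> circle_of (a \<union> b) w"
proof -
  note A = crossingless_matchingsD[OF a] and B = crossingless_matchingsD[OF b]
  obtain e where e: "e \<in> b - a" "\<And>e'. e' \<in> b - a \<Longrightarrow> snd e - fst e \<le> snd e' - fst e'"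
    using ne ex_has_least_nat[of "\<lambda>e. e \<in> b - a" _ "\<lambda>e. snd e - fst e"] by blast
  obtain i j where ij: "e = (i, j)" by (cases e)
  have bij: "(i, j) \<in> b" "(i, j) \<notin> a" using e(1) ij by auto
  have lij: "i < j" using crossingless_matchings_less[OF b bij(1)] .
  have Fij: "i \<in> Field a" "j \<in> Field a" using bij(1) FieldI1 FieldI2 unfolding A(2) B(2)[symmetric] by fast+
  define p where "p = partner a i"
  define q where "q = partner a j"
  have pe: "(i, p) \<in> a \<or> (p, i) \<in> a" and qe: "(j, q) \<in> a \<or> (q, j) \<in> a"
    unfolding p_def q_def using partner_edge[OF A(1)] Fij by auto
  \<comment> \<open>The partner of \<open>k\<close> in \<open>b\<close> is inside as well, since
    \<open>b\<close> has no crossings. This arc of \<open>b\<close> is shorter than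
    \<open>(i, j)\<close>, so by minimality it belongs to \<open>a\<close> and is the arc of
    \<open>a\<close> at \<open>k\<close>.\<close>
  have inside: "i < l \<and> l < j" if k: "i < k" "k < j" and kl: "(k, l) \<in> a \<or> (l, k) \<in> a" for k l
  proof -
    have "k \<in> Field b" using kl FieldI1 FieldI2 unfolding B(2) A(2)[symmetric] by fast
    then obtain l' where l': "(k, l') \<in> b \<or> (l', k) \<in> b" unfolding Field_iff ..
    have sep: "i < l' \<and> l' < j"
      using l'
    proof
      assume kb: "(k, l') \<in> b"
      have ne: "(i, j) \<noteq> (k, l')" using k by auto
      show ?thesis
        using noncrossing_not_separating[OF b bij(1) kb ne] arcs_disjoint[OF B(1) bij(1) kb ne] k lij by linarith
    next
      assume kb: "(l', k) \<in> b"
      have ne: "(i, j) \<noteq> (l', k)" using k by auto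
      show ?thesis
        using noncrossing_not_separating[OF b bij(1) kb ne] arcs_disjoint[OF B(1) bij(1) kb ne] k lij by linarith
    qed
    have "(k, l') \<in> a \<or> (l', k) \<in> a"
    proof -
      have "j - i > l' - k" "j - i > k - l'" using k sep by linarith+
      then show ?thesis using l' e(2)[of "(k, l')"] e(2)[of "(l', k)"] unfolding ij by auto
    qed
    then have "l' = l" using pmatch_unique[OF A(1) _ kl] by blast
    then show ?thesis using sep by simp
  qed
  have ne_pj: "p \<noteq> j" "q \<noteq> i"
    using pe qe bij(2) lij crossingless_matchings_less[OF a] by (auto dest: less_asym)
  have ne_pq: "p \<noteq> i" "q \<noteq> j" "p \<noteq> q"
    using pe qe pmatch_irrefl[OF A(1)] pmatch_unique[OF A(1), of q i j] lij by auto
  have pout: "\<not> (i < p \<and> p < j)" using inside[of p i] pe by auto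
  have qout: "\<not> (i < q \<and> q < j)" using inside[of q j] qe by auto
  \<comment> \<open>The surgery joins the former partners \<open>p\<close> and \<open>q\<close>.
    Their order is still open, hence the minimum and maximum here and the conditionals in the two
    removed arcs \<open>\<alpha>\<close> and \<open>\<beta>\<close>.\<close>
  define u where "u = min p q"
  define v where "v = max p q"
  define \<alpha> where "\<alpha> = (if i < p then (i, p) else (p, i))"
  define \<beta> where "\<beta> = (if j < q then (j, q) else (q, j))"
  have \<alpha>: "\<alpha> \<in> a" and \<beta>: "\<beta> \<in> a"
    unfolding \<alpha>_def \<beta>_def
    using pe qe crossingless_matchings_less[OF a, of i p] crossingless_matchings_less[OF a, of p i]
      crossingless_matchings_less[OF a, of j q] crossingless_matchings_less[OF a, of q j] by auto
  define r where "r = a - {\<alpha>, \<beta>}"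
  define a' where "a' = insert (u, v) (insert (i, j) r)"
  have a_eq: "a = r \<union> {\<alpha>, \<beta>}" using \<alpha> \<beta> r_def by auto
  have Fr: "Field r = {1..2 * n} - {i, j, p, q}"
  proof -
    have "Field {\<alpha>, \<beta>} = {i, j, p, q}" by (auto simp: \<alpha>_def \<beta>_def Field_def)
    then show ?thesis unfolding r_def using pmatch_Field_Diff[OF A(1), of "{\<alpha>, \<beta>}"] \<alpha> \<beta> A(2) by simp
  qed
  have pr: "pmatch r" using A(1) by (rule pmatch_subset) (auto simp: r_def)
  have uv: "u < v" "{u, v} = {p, q}" using ne_pq(3) by (auto simp: u_def v_def min_def max_def)
  have pm: "pmatch a'" unfolding a'_def
  proof (intro pmatch_insert pr)
    show "u \<notin> Field (insert (i, j) r)" "v \<notin> Field (insert (i, j) r)"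
    proof -
      have "Field (insert (i, j) r) = insert i (insert j (Field r))" by (simp add: Field_insert)
      moreover have "u \<in> {p, q}" "v \<in> {p, q}" using uv(2) by blast+
      ultimately show "u \<notin> Field (insert (i, j) r)" "v \<notin> Field (insert (i, j) r)"
        unfolding Fr using ne_pj ne_pq by blast+
    qed
    show "i \<noteq> j" "u \<noteq> v" using lij uv(1) by simp_all
    show "i \<notin> Field r" "j \<notin> Field r" unfolding Fr by blast+
  qed
  have Fa: "{i, j, p, q} \<subseteq> {1..2 * n}" unfolding A(2)[symmetric] using Fij pe qe FieldI1[of _ _ a] FieldI2[of _ _ a] by blast
  have Fa': "Field a' = {1..2 * n}"
  proof -
    have "Field a' = {u, v} \<union> insert i (insert j (Field r))" unfolding a'_def by (simp add: Field_insert)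
    then show ?thesis unfolding uv(2) Fr using Fa by blast
  qed
  have less': "k < l" if "(k, l) \<in> a'" for k l
  proof -
    have "(k, l) \<in> a \<or> (k, l) = (u, v) \<or> (k, l) = (i, j)" using that unfolding a'_def r_def by blast
    then show ?thesis using uv(1) lij crossingless_matchings_less[OF a, of k l] by blast
  qed
  have sepij: "(i < k) \<noteq> (j < k) \<longleftrightarrow> (i < l) \<noteq> (j < l)" if kl: "(k, l) \<in> r" for k l
  proof -
    have "(k, l) \<in> a" using kl by (simp add: r_def)
    moreover have "k \<notin> {i, j}" "l \<notin> {i, j}" using kl Fr FieldI1[OF kl] FieldI2[OF kl] by auto
    ultimately show ?thesis using inside[of k l] inside[of l k] lij by auto
  qed
  text \<open>Modulo 2, the arc from \<open>p\<close> to \<open>q\<close> is homologous to the sum of the arcs at \<open>i\<close>, at \<open>j\<close>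
    and from \<open>i\<close> to \<open>j\<close>, none of which separates the endpoints of an arc in \<open>r\<close>.\<close>
  have sepuv: "(u < k) \<noteq> (v < k) \<longleftrightarrow> (u < l) \<noteq> (v < l)" if kl: "(k, l) \<in> r" for k l
  proof -
    have kla: "(k, l) \<in> a" "\<alpha> \<noteq> (k, l)" "\<beta> \<noteq> (k, l)" using kl by (auto simp: r_def)
    have "(i < k) \<noteq> (p < k) \<longleftrightarrow> (i < l) \<noteq> (p < l)"
      using noncrossing_not_separating[OF a _ kla(1), of "fst \<alpha>" "snd \<alpha>"] \<alpha> kla(2)
      by (auto simp: \<alpha>_def split: if_splits)
    moreover have "(j < k) \<noteq> (q < k) \<longleftrightarrow> (j < l) \<noteq> (q < l)"
      using noncrossing_not_separating[OF a _ kla(1), of "fst \<beta>" "snd \<beta>"] \<beta> kla(3)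
      by (auto simp: \<beta>_def split: if_splits)
    ultimately have "(p < k) \<noteq> (q < k) \<longleftrightarrow> (p < l) \<noteq> (q < l)" using sepij[OF kl] by blast
    then show ?thesis unfolding u_def v_def by (cases "p \<le> q") (auto simp: min_def max_def)
  qed
  have a'CM: "a' \<in> crossingless_matchings n"
  proof (rule crossingless_matchingsI[OF pm Fa' less'])
    fix k l s t assume kl: "(k, l) \<in> a'" and st: "(s, t) \<in> a'" and o: "k < s" "s < l" "l < t"
    have rr: False if "(k, l) \<in> r" "(s, t) \<in> r"
      using that crossingless_matchings_noncrossing[OF a, of k l s t] o by (auto simp: r_def)
    have ru: False if "(k, l) \<in> r" "(s, t) = (u, v)" using sepuv[OF that(1)] that(2) o by auto
    have ur: False if "(k, l) = (u, v)" "(s, t) \<in> r" using sepuv[OF that(2)] that(1) o by auto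
    have ri: False if "(k, l) \<in> r" "(s, t) = (i, j)" using sepij[OF that(1)] that(2) o by auto
    have ir: False if "(k, l) = (i, j)" "(s, t) \<in> r" using sepij[OF that(2)] that(1) o by auto
    have ui: False if "(k, l) = (u, v)" "(s, t) = (i, j)"
      using that o pout qout uv(2) by auto
    have iu: False if "(k, l) = (i, j)" "(s, t) = (u, v)"
      using that o pout qout uv(2) by auto
    show False using kl st rr ru ur ri ir ui iu o unfolding a'_def by auto
  qed
  have dec: "card (b - a') < card (b - a)"
  proof (rule psubset_card_mono)
    show "finite (b - a)" using B(3) by simp
    \<comment> \<open>In \<open>b\<close> the points \<open>i\<close> and \<open>j\<close> are
      matched with each other, so the surgery removes no arc of \<open>b\<close> and gains
      \<open>(i, j)\<close>.\<close>
    have "\<alpha> \<notin> b" "\<beta> \<notin> b"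
      using pmatch_unique[OF B(1), of i j p] pmatch_unique[OF B(1), of j i q] bij(1) ne_pj
      by (auto simp: \<alpha>_def \<beta>_def)
    then have "b - a' \<subseteq> b - a" unfolding a'_def a_eq by auto
    moreover have "(i, j) \<in> b - a" "(i, j) \<notin> b - a'" using bij by (auto simp: a'_def)
    ultimately show "b - a' \<subset> b - a" by blast
  qed
  have con: "{i, j, p, q} \<subseteq> circle_of (a \<union> b) w" if "w \<in> {i, j, p, q}" for w
  proof -
    have c: "(i, j) \<in> conn (a \<union> b)" "(i, p) \<in> conn (a \<union> b)" "(j, q) \<in> conn (a \<union> b)"
      using bij(1) pe qe by (auto intro: conn_edge conn_sym)
    then have i: "(i, k) \<in> conn (a \<union> b)" if "k \<in> {i, j, p, q}" for k
      using that by (auto intro: conn_trans)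
    show ?thesis using conn_trans[OF conn_sym[OF i[OF \<open>w \<in> {i, j, p, q}\<close>]] i] by (auto simp: in_circle_of)
  qed
  \<comment> \<open>The other orders of \<open>p\<close> and \<open>q\<close> would make
    \<open>\<alpha>\<close> and \<open>\<beta>\<close> cross. In the first case they are side by
    side and the surgery nests them; in the other two it is the reverse.\<close>
  consider "p < i" "j < q" | "j < q" "q < p" | "q < p" "p < i"
  proof -
    have "\<not> (j < p \<and> q < i)" using \<alpha> \<beta> lij crossingless_matchings_noncrossing[OF a, of q j i p]
      by (auto simp: \<alpha>_def \<beta>_def)
    moreover have "\<not> (j < p \<and> p < q)" using \<alpha> \<beta> lij crossingless_matchings_noncrossing[OF a, of i p j q]
      by (auto simp: \<alpha>_def \<beta>_def)
    moreover have "\<not> (p < q \<and> q < i)" using \<alpha> \<beta> lij crossingless_matchings_noncrossing[OF a, of p i q j]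
      by (auto simp: \<alpha>_def \<beta>_def)
    moreover have "p < i \<or> j < p" "q < i \<or> j < q" using pout qout ne_pj ne_pq by auto
    ultimately show ?thesis using that ne_pq(3) by (meson less_trans linorder_less_linear)
  qed
  then show ?thesis
  proof cases
    case 1
    then have "\<alpha> = (p, i)" "\<beta> = (j, q)" "(u, v) = (p, q)" using lij by (auto simp: \<alpha>_def \<beta>_def u_def v_def)
    then have "a = r \<union> {(p, i), (j, q)}" "a' = r \<union> {(p, q), (i, j)}" using a_eq a'_def by auto
    then show ?thesis using that[of p i j q r a'] 1 lij a'CM dec con[of p] by auto
  next
    case 2
    then have "\<alpha> = (i, p)" "\<beta> = (j, q)" "(u, v) = (q, p)" using lij by (auto simp: \<alpha>_def \<beta>_def u_def v_def)
    then have "a = r \<union> {(i, p), (j, q)}" "a' = r \<union> {(i, j), (q, p)}" using a_eq a'_def by auto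
    then show ?thesis using that[of i j q p r a'] 2 lij a'CM dec con[of i] by auto
  next
    case 3
    then have "\<alpha> = (p, i)" "\<beta> = (q, j)" "(u, v) = (q, p)" using lij by (auto simp: \<alpha>_def \<beta>_def u_def v_def)
    then have "a = r \<union> {(q, j), (p, i)}" "a' = r \<union> {(q, p), (i, j)}" using a_eq a'_def by auto
    then show ?thesis using that[of q p i j r a'] 3 lij a'CM dec con[of q] by auto
  qed
qed

section \<open>Skein sums\<close>

lemma sum_Pow_insert:
  fixes f :: "'a set \<Rightarrow> 'b :: comm_monoid_add"
  assumes "finite A" "e \<notin> A"
  shows "sum f (Pow (insert e A)) = (\<Sum>D\<in>Pow A. f D + f (insert e D))"
proof -
  have "inj_on (insert e) (Pow A)" by (intro inj_onI) (metis PowD assms(2) insert_ident subsetD)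
  moreover have "Pow A \<inter> insert e ` Pow A = {}" using assms(2) by blast
  ultimately show ?thesis unfolding Pow_insert using assms(1)
    by (simp add: sum.union_disjoint sum.reindex sum.distrib)
qed

definition undotted :: "matching \<Rightarrow> (nat \<times> nat) set \<Rightarrow> nat set \<Rightarrow> nat" where
  "undotted m D c = card {(i, j) \<in> m - D. i \<in> c \<and> j \<in> c}"

text \<open>\<open>w c\<close> is the number of \<open>X\<close>-labels to be multiplied and comultiplied onto the arcs in \<open>c\<close>.\<close>

definition skein_sum :: "matching \<Rightarrow> nat set set \<Rightarrow> (nat set \<Rightarrow> nat) \<Rightarrow> diagram \<Rightarrow>\<^sub>0 int" where
  "skein_sum m P w =
    (\<Sum>D\<in>Pow m. if \<forall>c\<in>P. w c + undotted m D c = 1 then frag_of (m, D) else 0)"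

abbreviation skein_relators :: "nat \<Rightarrow> (diagram \<Rightarrow>\<^sub>0 int) set" where
  "skein_relators n \<equiv> generate (free_Abelian_group (diagrams n)) (type_I_relations n \<union> type_II_relations n)"

lemma undotted_insert:
  assumes "finite r" "(i, j) \<notin> r"
  shows "undotted (insert (i, j) r) D c = undotted r D c + of_bool ((i, j) \<notin> D \<and> i \<in> c \<and> j \<in> c)"
proof -
  have fin: "finite {(i, j) \<in> r - D. i \<in> c \<and> j \<in> c}"
    by (rule finite_subset[OF _ assms(1)]) auto
  show ?thesis
  proof (cases "(i, j) \<notin> D \<and> i \<in> c \<and> j \<in> c")
    case True
    then have "{(i', j') \<in> insert (i, j) r - D. i' \<in> c \<and> j' \<in> c} =
        insert (i, j) {(i, j) \<in> r - D. i \<in> c \<and> j \<in> c}" by auto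
    then show ?thesis unfolding undotted_def using True fin assms(2) by simp
  next
    case False
    then have "{(i', j') \<in> insert (i, j) r - D. i' \<in> c \<and> j' \<in> c} = {(i, j) \<in> r - D. i \<in> c \<and> j \<in> c}" by auto
    then show ?thesis unfolding undotted_def using False by simp
  qed
qed

lemma undotted_cong: "D \<inter> r = D' \<inter> r \<Longrightarrow> undotted r D c = undotted r D' c"
  unfolding undotted_def by (rule arg_cong[where f = card]) auto

text \<open>The contribution of two arcs on one circle, where \<open>s\<close> is what the circle
  already counts. For \<open>s = 0\<close> exactly one arc is undotted, for \<open>s = 1\<close>
  none is, and a larger \<open>s\<close> is incompatible. The first two values give the sides of the
  relations of types I and II.\<close>

definition two_arcs_term ::
  "matching \<Rightarrow> nat \<times> nat \<Rightarrow> nat \<times> nat \<Rightarrow> nat \<Rightarrow> (nat \<times> nat) set \<Rightarrow> diagram \<Rightarrow>\<^sub>0 int" where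
  "two_arcs_term r e1 e2 s D =
    (if s = 0 then frag_of (r \<union> {e1, e2}, D \<union> {e1}) + frag_of (r \<union> {e1, e2}, D \<union> {e2})
     else if s = 1 then frag_of (r \<union> {e1, e2}, D \<union> {e1, e2}) else 0)"

text \<open>Only the condition at \<open>c0\<close> sees the two arcs. Summing over their four
  dottings first thus leaves a sum over the dottings \<open>D\<close> of the common arcs.\<close>

lemma skein_sum_two_arcs:
  assumes r: "finite r" "(i, j) \<notin> r" "(k, l) \<notin> r" "(i, j) \<noteq> (k, l)"
    and c0: "c0 \<in> P" "{i, j, k, l} \<subseteq> c0" "\<And>c. c \<in> P \<Longrightarrow> c \<noteq> c0 \<Longrightarrow> c \<inter> c0 = {}"
  shows "skein_sum (r \<union> {(i, j), (k, l)}) P w =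
    (\<Sum>D\<in>Pow r. if \<forall>c\<in>P - {c0}. w c + undotted r D c = 1
      then two_arcs_term r (i, j) (k, l) (w c0 + undotted r D c0) D else 0)"
proof -
  let ?e = "(i, j)" and ?f = "(k, l)"
  let ?m = "insert ?e (insert ?f r)"
  have m: "r \<union> {?e, ?f} = ?m" by auto
  have u: "undotted ?m (D \<union> E) c = undotted r D c + (if c = c0 then card ({?e, ?f} - E) else 0)"
    if "c \<in> P" "D \<subseteq> r" "E \<subseteq> {?e, ?f}" for c D E
  proof -
    have "undotted r (D \<union> E) c = undotted r D c"
      using that r by (intro undotted_cong) auto
    moreover have "card ({?e, ?f} - E) = of_bool (?e \<notin> E) + of_bool (?f \<notin> E)"
    proof -
      have "{?e, ?f} - E = (if ?e \<in> E then {} else {?e}) \<union> (if ?f \<in> E then {} else {?f})" by auto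
      then show ?thesis using r(4) by auto
    qed
    moreover have "?e \<notin> D" "?f \<notin> D" using that(2) r by auto
    moreover have "i \<in> c \<longleftrightarrow> c = c0" "k \<in> c \<longleftrightarrow> c = c0" "c = c0 \<Longrightarrow> j \<in> c \<and> l \<in> c"
      using c0 that(1) by blast+
    moreover have "?e \<notin> insert ?f r" using r by auto
    ultimately show ?thesis using r
      by (auto simp: undotted_insert)
  qed
  let ?A = "\<lambda>D. \<forall>c\<in>P - {c0}. w c + undotted r D c = 1"
  let ?s = "\<lambda>D. w c0 + undotted r D c0"
  define g where "g D = (if \<forall>c\<in>P. w c + undotted ?m D c = 1 then frag_of (?m, D) else 0)" for D
  have g: "g (D \<union> E) = (if ?A D \<and> ?s D + card ({?e, ?f} - E) = 1 then frag_of (?m, D \<union> E) else 0)"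
    if "D \<subseteq> r" "E \<subseteq> {?e, ?f}" for D E
  proof -
    have "(\<forall>c\<in>P. w c + undotted ?m (D \<union> E) c = 1) \<longleftrightarrow>
        (\<forall>c\<in>P - {c0}. w c + undotted ?m (D \<union> E) c = 1) \<and> w c0 + undotted ?m (D \<union> E) c0 = 1"
      using c0(1) by blast
    also have "\<dots> \<longleftrightarrow> ?A D \<and> ?s D + card ({?e, ?f} - E) = 1"
      using u[OF _ that] c0(1) by (simp add: add.assoc)
    finally show ?thesis unfolding g_def by simp
  qed
  have "skein_sum ?m P w = sum g (Pow ?m)" unfolding skein_sum_def g_def ..
  also have "\<dots> = (\<Sum>D\<in>Pow r. (g D + g (insert ?e D)) + (g (insert ?f D) + g (insert ?e (insert ?f D))))"
    using r by (simp add: sum_Pow_insert)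
  also have "\<dots> = (\<Sum>D\<in>Pow r. if ?A D then two_arcs_term r ?e ?f (?s D) D else 0)"
  proof (rule sum.cong)
    fix D assume "D \<in> Pow r"
    then have D: "D \<subseteq> r" by simp
    have card: "card ({?e, ?f} - {}) = 2" "card ({?e, ?f} - {?e}) = 1" "card ({?e, ?f} - {?f}) = 1" "card ({?e, ?f} - {?e, ?f}) = 0"
    proof -
      have "{?e, ?f} - {?e} = {?f}" "{?e, ?f} - {?f} = {?e}" using r(4) by auto
      then show "card ({?e, ?f} - {}) = 2" "card ({?e, ?f} - {?e}) = 1" "card ({?e, ?f} - {?f}) = 1" "card ({?e, ?f} - {?e, ?f}) = 0"
        using r(4) by simp_all
    qed
    have "g D = g (D \<union> {})" "g (insert ?e D) = g (D \<union> {?e})" "g (insert ?f D) = g (D \<union> {?f})"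
      "g (insert ?e (insert ?f D)) = g (D \<union> {?e, ?f})" by simp_all
    then show "(g D + g (insert ?e D)) + (g (insert ?f D) + g (insert ?e (insert ?f D))) =
        (if ?A D then two_arcs_term r ?e ?f (?s D) D else 0)"
      using g[OF D, of "{}"] g[OF D, of "{?e}"] g[OF D, of "{?f}"] g[OF D, of "{?e, ?f}"]
      unfolding card two_arcs_term_def m by auto
  qed simp
  finally show ?thesis unfolding m .
qed

section \<open>The subgroup of skein relations and moves inside a circle\<close>

lemma subgroup_free_Abelian_group:
  assumes "subgroup H (free_Abelian_group S)"
  shows "0 \<in> H" "x \<in> H \<Longrightarrow> y \<in> H \<Longrightarrow> x + y \<in> H" "x \<in> H \<Longrightarrow> - x \<in> H" "x \<in> H \<Longrightarrow> y \<in> H \<Longrightarrow> x - y \<in> H"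
    "(\<And>i. i \<in> I \<Longrightarrow> f i \<in> H) \<Longrightarrow> sum f I \<in> H"
proof -
  show zero: "0 \<in> H" using subgroup.one_closed[OF assms] by simp
  show add: "x + y \<in> H" if "x \<in> H" "y \<in> H" for x y using subgroup.m_closed[OF assms that] by simp
  show minus: "- x \<in> H" if "x \<in> H" for x
  proof -
    have "Poly_Mapping.keys x \<subseteq> S" using subgroup.mem_carrier[OF assms that] by simp
    then show ?thesis using subgroup.m_inv_closed[OF assms that] by simp
  qed
  show "x - y \<in> H" if "x \<in> H" "y \<in> H" using add[OF that(1) minus[OF that(2)]] by simp
  show "sum f I \<in> H" if "\<And>i. i \<in> I \<Longrightarrow> f i \<in> H"
    using that by (induction I rule: infinite_finite_induct) (auto intro: zero add)
qed

lemma keys_diff_subset: "Poly_Mapping.keys x \<subseteq> S \<Longrightarrow> Poly_Mapping.keys y \<subseteq> S \<Longrightarrow> Poly_Mapping.keys (x - y) \<subseteq> S"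
  for x y :: "'a \<Rightarrow>\<^sub>0 int"
  using keys_diff[of x y] by blast

lemma keys_add_subset: "Poly_Mapping.keys x \<subseteq> S \<Longrightarrow> Poly_Mapping.keys y \<subseteq> S \<Longrightarrow> Poly_Mapping.keys (x + y) \<subseteq> S"
  for x y :: "'a \<Rightarrow>\<^sub>0 int"
  using Poly_Mapping.keys_add[of x y] by blast

lemma relations_in_carrier:
  "type_I_relations n \<union> type_II_relations n \<subseteq> carrier (free_Abelian_group (diagrams n))"
proof (intro Un_least subsetI)
  fix x assume "x \<in> type_I_relations n"
  then obtain a b c d r D where x: "x = frag_of (r \<union> {(a, b), (c, d)}, D \<union> {(a, b)}) + frag_of (r \<union> {(a, b), (c, d)}, D \<union> {(c, d)})
      - (frag_of (r \<union> {(a, d), (b, c)}, D \<union> {(a, d)}) + frag_of (r \<union> {(a, d), (b, c)}, D \<union> {(b, c)}))"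
    and D: "D \<subseteq> r" "r \<union> {(a, b), (c, d)} \<in> crossingless_matchings n" "r \<union> {(a, d), (b, c)} \<in> crossingless_matchings n"
    unfolding type_I_relations_def by blast
  show "x \<in> carrier (free_Abelian_group (diagrams n))"
    unfolding x carrier_free_Abelian_group_iff
    by (intro keys_diff_subset keys_add_subset) (use D in \<open>auto simp: diagrams_def\<close>)
next
  fix x assume "x \<in> type_II_relations n"
  then obtain a b c d r D where x: "x = frag_of (r \<union> {(a, b), (c, d)}, D \<union> {(a, b), (c, d)})
      - frag_of (r \<union> {(a, d), (b, c)}, D \<union> {(a, d), (b, c)})"
    and D: "D \<subseteq> r" "r \<union> {(a, b), (c, d)} \<in> crossingless_matchings n" "r \<union> {(a, d), (b, c)} \<in> crossingless_matchings n"
    unfolding type_II_relations_def by blast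
  show "x \<in> carrier (free_Abelian_group (diagrams n))"
    unfolding x carrier_free_Abelian_group_iff
    by (intro keys_diff_subset) (use D in \<open>auto simp: diagrams_def\<close>)
qed

lemma subgroup_skein_relators: "subgroup (skein_relators n) (free_Abelian_group (diagrams n))"
  by (rule group.generate_is_subgroup[OF group_free_Abelian_group relations_in_carrier])

lemma two_arcs_term_diff:
  assumes "w < x" "x < y" "y < z" "D \<subseteq> r"
    "r \<union> {(w, x), (y, z)} \<in> crossingless_matchings n" "r \<union> {(w, z), (x, y)} \<in> crossingless_matchings n"
  shows "two_arcs_term r (w, x) (y, z) s D - two_arcs_term r (w, z) (x, y) s D \<in> skein_relators n"
proof -
  note sg = subgroup_free_Abelian_group[OF subgroup_skein_relators]
  consider "s = 0" | "s = 1" | "s > 1" by linarith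
  then show ?thesis
  proof cases
    case 1
    have "two_arcs_term r (w, x) (y, z) s D - two_arcs_term r (w, z) (x, y) s D \<in> type_I_relations n"
      unfolding type_I_relations_def two_arcs_term_def
      by (intro CollectI exI[of _ w] exI[of _ x] exI[of _ y] exI[of _ z] exI[of _ r] exI[of _ D])
        (use assms 1 in simp)
    then show ?thesis by (auto intro: generate.incl)
  next
    case 2
    have "two_arcs_term r (w, x) (y, z) s D - two_arcs_term r (w, z) (x, y) s D \<in> type_II_relations n"
      unfolding type_II_relations_def two_arcs_term_def
      by (intro CollectI exI[of _ w] exI[of _ x] exI[of _ y] exI[of _ z] exI[of _ r] exI[of _ D])
        (use assms 2 in simp)
    then show ?thesis by (auto intro: generate.incl)
  next
    case 3 then show ?thesis using sg(1) by (simp add: two_arcs_term_def)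
  qed
qed

lemma two_arcs_not_in:
  assumes "w < x" "x < y" "y < z"
    "r \<union> {(w, x), (y, z)} \<in> crossingless_matchings n" "r \<union> {(w, z), (x, y)} \<in> crossingless_matchings n"
  shows "finite r" "(w, x) \<notin> r" "(y, z) \<notin> r" "(w, z) \<notin> r" "(x, y) \<notin> r"
proof -
  note A = crossingless_matchingsD[OF assms(4)] and B = crossingless_matchingsD[OF assms(5)]
  show "finite r" using A(3) by simp
  show "(w, x) \<notin> r" using pmatchD[OF B(1), of w x w z] assms(1-3) by auto
  show "(y, z) \<notin> r" using pmatchD[OF B(1), of y z x y] assms(1-3) by auto
  show "(w, z) \<notin> r" using pmatchD[OF A(1), of w z w x] assms(1-3) by auto
  show "(x, y) \<notin> r" using pmatchD[OF A(1), of x y w x] assms(1-3) by auto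
qed

text \<open>For each dotting of the common arcs, both sums carry the same conditions and the same
  value of \<open>s\<close>. So the difference is a sum of differences handled by
  \<open>two_arcs_term_diff\<close>.\<close>

lemma skein_sum_move:
  assumes wxyz: "w < x" "x < y" "y < z"
    and m: "r \<union> {(w, x), (y, z)} \<in> crossingless_matchings n" "r \<union> {(w, z), (x, y)} \<in> crossingless_matchings n"
    and c0: "c0 \<in> P" "{w, x, y, z} \<subseteq> c0" "\<And>c. c \<in> P \<Longrightarrow> c \<noteq> c0 \<Longrightarrow> c \<inter> c0 = {}"
  shows "skein_sum (r \<union> {(w, x), (y, z)}) P v - skein_sum (r \<union> {(w, z), (x, y)}) P v \<in> skein_relators n"
proof -
  note r = two_arcs_not_in[OF wxyz m]
  note sg = subgroup_free_Abelian_group[OF subgroup_skein_relators]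
  let ?A = "\<lambda>D. \<forall>c\<in>P - {c0}. v c + undotted r D c = 1"
  let ?s = "\<lambda>D. v c0 + undotted r D c0"
  have 1: "skein_sum (r \<union> {(w, x), (y, z)}) P v = (\<Sum>D\<in>Pow r. if ?A D then two_arcs_term r (w, x) (y, z) (?s D) D else 0)"
    by (rule skein_sum_two_arcs) (use r wxyz c0 in auto)
  have 2: "skein_sum (r \<union> {(w, z), (x, y)}) P v = (\<Sum>D\<in>Pow r. if ?A D then two_arcs_term r (w, z) (x, y) (?s D) D else 0)"
    by (rule skein_sum_two_arcs) (use r wxyz c0 in auto)
  have "skein_sum (r \<union> {(w, x), (y, z)}) P v - skein_sum (r \<union> {(w, z), (x, y)}) P v =
    (\<Sum>D\<in>Pow r. if ?A D then two_arcs_term r (w, x) (y, z) (?s D) D - two_arcs_term r (w, z) (x, y) (?s D) D else 0)"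
    unfolding 1 2 sum_subtractf[symmetric] by (rule sum.cong) auto
  also have "\<dots> \<in> skein_relators n"
    by (rule sg(5)) (use two_arcs_term_diff[OF wxyz _ m] sg(1) in auto)
  finally show ?thesis .
qed

text \<open>Induction on the number of arcs of \<open>b\<close> missing from \<open>a\<close>. The
  circles come from a fixed \<open>E\<close> rather than from \<open>a \<union> b\<close>, because
  \<open>a\<close> changes while the partition and its weights must not. Each surgery stays inside
  one circle of \<open>E\<close>, so its result is again contained in \<open>conn E\<close>.\<close>

lemma skein_sum_independent:
  assumes "a \<in> crossingless_matchings n" "b \<in> crossingless_matchings n" "a \<union> b \<subseteq> conn E" "Field E = {1..2 * n}"
  shows "skein_sum a (circles E) v - skein_sum b (circles E) v \<in> skein_relators n"
  using assms(1,3)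
proof (induction "card (b - a)" arbitrary: a rule: less_induct)
  case less
  note sg = subgroup_free_Abelian_group[OF subgroup_skein_relators]
  show ?case
  proof (cases "b \<subseteq> a")
    case True
    note A = crossingless_matchingsD[OF less.prems(1)] and B = crossingless_matchingsD[OF assms(2)]
    \<comment> \<open>Both matchings cover all points, so inclusion is already equality.\<close>
    have "Field (a - b) = {}" using pmatch_Field_Diff[OF A(1) True] A(2) B(2) by simp
    then have "a - b = {}" by (metis FieldI1 equals0D equals0I surj_pair)
    then have "a = b" using True by blast
    then show ?thesis using sg(1) by simp
  next
    case False
    obtain a' r w x y z where o: "w < x" "x < y" "y < z"
      and eq: "a = r \<union> {(w, x), (y, z)} \<and> a' = r \<union> {(w, z), (x, y)} \<or>
        a' = r \<union> {(w, x), (y, z)} \<and> a = r \<union> {(w, z), (x, y)}"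
      and a': "a' \<in> crossingless_matchings n" "card (b - a') < card (b - a)"
      and con: "{w, x, y, z} \<subseteq> circle_of (a \<union> b) w"
      by (rule closer_matching[OF less.prems(1) assms(2) False])
    let ?c = "circle_of E w"
    have sub: "{w, x, y, z} \<subseteq> ?c"
      using con conn_subset[OF less.prems(2)] by (auto simp: in_circle_of)
    have pairs: "(s, t) \<in> conn E" if "s \<in> ?c" "t \<in> ?c" for s t
      using that conn_trans[OF conn_sym] by (auto simp: in_circle_of)
    have "w \<in> {1..2 * n}"
      using eq crossingless_matchingsD(2)[OF less.prems(1)] by (auto simp: Field_def)
    then have c: "?c \<in> circles E" using assms(4) by (auto intro: circle_of_in_circles)
    have dis: "c \<inter> ?c = {}" if "c \<in> circles E" "c \<noteq> ?c" for c
      using circles_disjoint[OF that(1) c] that(2) by blast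
    have "skein_sum a (circles E) v - skein_sum a' (circles E) v \<in> skein_relators n"
      using eq
    proof
      assume e: "a = r \<union> {(w, x), (y, z)} \<and> a' = r \<union> {(w, z), (x, y)}"
      then show ?thesis using skein_sum_move[OF o _ _ c sub dis, of r n v] less.prems(1) a'(1) by blast
    next
      assume e: "a' = r \<union> {(w, x), (y, z)} \<and> a = r \<union> {(w, z), (x, y)}"
      then have "skein_sum a' (circles E) v - skein_sum a (circles E) v \<in> skein_relators n"
        using skein_sum_move[OF o _ _ c sub dis, of r n v] less.prems(1) a'(1) by blast
      from sg(3)[OF this] show ?thesis by simp
    qed
    moreover have "skein_sum a' (circles E) v - skein_sum b (circles E) v \<in> skein_relators n"
    proof (rule less.hyps[OF a'(2,1)])
      have "a' \<subseteq> a \<union> {(w, x), (y, z), (w, z), (x, y)}" using eq by auto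
      moreover have "{(w, x), (y, z), (w, z), (x, y)} \<subseteq> conn E" using sub pairs by auto
      ultimately show "a' \<union> b \<subseteq> conn E" using less.prems(2) by blast
    qed
    ultimately show ?thesis using sg(2) by fastforce
  qed
qed

section \<open>The isomorphism\<close>

definition arc_set :: "nat \<times> nat \<Rightarrow> nat set" where
  "arc_set e = {fst e, snd e}"

lemma arc_set_inj:
  assumes "pmatch m" shows "inj_on arc_set m"
  using assms unfolding inj_on_def pmatch_def arc_set_def by blast

lemma circle_of_common_arc:
  assumes "pmatch m" "pmatch m'" "(i, j) \<in> m" "(i, j) \<in> m'"
  shows "circle_of (m \<union> m') i = {i, j}" "circle_of (m \<union> m') j = {i, j}"
proof -
  have closed: "u \<in> {i, j} \<longleftrightarrow> v \<in> {i, j}" if "(u, v) \<in> m \<union> m'" for u v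
    using that pmatchD[OF assms(1) _ assms(3), of u v] pmatchD[OF assms(2) _ assms(4), of u v] by blast
  have i: "circle_of (m \<union> m') i \<subseteq> {i, j}" by (rule circle_of_subset_closed[OF _ closed]) simp
  have "(i, j) \<in> conn (m \<union> m')" by (rule conn_edge) (use assms in auto)
  then have "circle_of (m \<union> m') i = circle_of (m \<union> m') j" "j \<in> circle_of (m \<union> m') i"
    by (auto simp: circle_of_eq_iff in_circle_of)
  with i show "circle_of (m \<union> m') i = {i, j}" "circle_of (m \<union> m') j = {i, j}"
    using circle_of_self[of i "m \<union> m'"] by blast+
qed

text \<open>The 1-manifold \<open>W(m)m\<close> has edge set \<open>m \<union> m = m\<close>, and
  each of its circles is a doubled arc.\<close>

lemma circles_pmatch:
  assumes "pmatch m" shows "circles m = arc_set ` m"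
proof (intro equalityI subsetI)
  fix c assume "c \<in> circles m"
  then obtain k where k: "k \<in> Field m" "c = circle_of m k" by (auto simp: circles_def)
  then obtain j where "(k, j) \<in> m \<or> (j, k) \<in> m" unfolding Field_iff by blast
  then show "c \<in> arc_set ` m"
  proof
    assume a: "(k, j) \<in> m"
    then have "c = arc_set (k, j)" using circle_of_common_arc(1)[OF assms assms a a] k by (simp add: arc_set_def)
    then show ?thesis using a by blast
  next
    assume a: "(j, k) \<in> m"
    then have "c = arc_set (j, k)" using circle_of_common_arc(2)[OF assms assms a a] k by (simp add: arc_set_def)
    then show ?thesis using a by blast
  qed
next
  fix c assume "c \<in> arc_set ` m"
  then obtain i j where a: "(i, j) \<in> m" "c = arc_set (i, j)" by auto
  then have "c = circle_of m i" using circle_of_common_arc(1)[OF assms assms a(1) a(1)] by (simp add: arc_set_def)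
  then show "c \<in> circles m" using FieldI1[OF a(1)] by (auto intro: circle_of_in_circles)
qed

definition dots :: "matching \<Rightarrow> nat labelling \<Rightarrow> (nat \<times> nat) set" where
  "dots m l = {e \<in> m. l (arc_set e) = AX}"

definition dot_labelling :: "matching \<Rightarrow> (nat \<times> nat) set \<Rightarrow> nat labelling" where
  "dot_labelling m D = restrict (\<lambda>c. if c \<in> arc_set ` D then AX else A1) (circles m)"

lemma dot_labelling_arc:
  assumes "pmatch m" "D \<subseteq> m" "e \<in> m"
  shows "dot_labelling m D (arc_set e) = (if e \<in> D then AX else A1)"
proof -
  have "arc_set e \<in> arc_set ` D \<longleftrightarrow> e \<in> D"
    using inj_on_image_mem_iff[OF arc_set_inj[OF assms(1)] assms(3,2)] .
  then show ?thesis using assms(3) unfolding dot_labelling_def circles_pmatch[OF assms(1)] by simp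
qed

lemma dot_labelling_in_labellings: "dot_labelling m D \<in> labellings m"
  unfolding dot_labelling_def labellings_def by simp

lemma dots_subset: "dots m l \<subseteq> m"
  by (auto simp: dots_def)

lemma dots_dot_labelling: "pmatch m \<Longrightarrow> D \<subseteq> m \<Longrightarrow> dots m (dot_labelling m D) = D"
proof -
  assume "pmatch m" "D \<subseteq> m"
  then have "dot_labelling m D (arc_set e) = AX \<longleftrightarrow> e \<in> D" if "e \<in> m" for e
    using that by (simp add: dot_labelling_arc)
  then show ?thesis unfolding dots_def using \<open>D \<subseteq> m\<close> by blast
qed

lemma dot_labelling_dots:
  assumes "pmatch m" "l \<in> labellings m"
  shows "dot_labelling m (dots m l) = l"
proof (rule PiE_ext)
  show "dot_labelling m (dots m l) \<in> circles m \<rightarrow>\<^sub>E UNIV" "l \<in> circles m \<rightarrow>\<^sub>E UNIV"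
    using dot_labelling_in_labellings assms(2) by (simp_all add: labellings_def)
  fix c assume "c \<in> circles m"
  then obtain e where e: "e \<in> m" "c = arc_set e" unfolding circles_pmatch[OF assms(1)] by blast
  from dot_labelling_arc[OF assms(1) dots_subset e(1)] show "dot_labelling m (dots m l) c = l c"
    using e by (cases "l c") (auto simp: dots_def)
qed

lemma bij_betw_dot_labelling: "pmatch m \<Longrightarrow> bij_betw (dot_labelling m) (Pow m) (labellings m)"
  by (rule bij_betwI[where g = "dots m"])
    (simp_all add: dot_labelling_in_labellings dots_dot_labelling dot_labelling_dots dots_subset)

lemma count_label_dot_labelling:
  assumes "pmatch m" "finite m" "D \<subseteq> m"
  shows "count_label m A1 (dot_labelling m D) Q = undotted m D Q"
proof -
  have "count_label m A1 (dot_labelling m D) Q =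
      (\<Sum>e\<in>m. of_bool (dot_labelling m D (arc_set e) = A1 \<and> arc_set e \<subseteq> Q))"
    unfolding count_label_def circles_pmatch[OF assms(1)] sum.reindex[OF arc_set_inj[OF assms(1)]] by (simp only: comp_def)
  also have "\<dots> = (\<Sum>e\<in>m. of_bool (e \<in> {(i, j) \<in> m - D. i \<in> Q \<and> j \<in> Q}))"
    by (rule sum.cong) (use dot_labelling_arc[OF assms(1,3)] in \<open>auto simp: arc_set_def\<close>)
  also have "\<dots> = card (m \<inter> {e. e \<in> {(i, j) \<in> m - D. i \<in> Q \<and> j \<in> Q}})"
    using assms(2) by simp
  also have "m \<inter> {e. e \<in> {(i, j) \<in> m - D. i \<in> Q \<and> j \<in> Q}} = {(i, j) \<in> m - D. i \<in> Q \<and> j \<in> Q}" by auto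
  finally show ?thesis unfolding undotted_def .
qed

fun diagram_to_arc :: "diagram \<Rightarrow> arc_basis \<Rightarrow>\<^sub>0 int" where
  "diagram_to_arc (m, D) = frag_of (m, m, dot_labelling m D)"

fun arc_to_diagram :: "arc_basis \<Rightarrow> diagram \<Rightarrow>\<^sub>0 int" where
  "arc_to_diagram (b, a, l) = (if b = a then frag_of (a, dots a l) else 0)"

text \<open>An outgoing label \<open>1\<close> is an undotted arc. The weight is symmetric in the
  two factors, so exchanging them only replaces the skein sum of \<open>a\<close> by that of
  \<open>b\<close> over the same circles.\<close>

lemma mult_opposite_skein_sum:
  assumes a: "a \<in> crossingless_matchings n" and b: "b \<in> crossingless_matchings n"
  shows "arc_basis_mult (a, b, l1) (b, a, l2) =
    frag_extend diagram_to_arc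
      (skein_sum a (circles (a \<union> b)) (\<lambda>Q. of_bool (l1 Q = AX) + of_bool (l2 Q = AX)))"
proof -
  note A = crossingless_matchingsD[OF a]
  let ?P = "\<lambda>l. \<forall>Q\<in>circles (a \<union> b). of_bool (l1 Q = AX) + of_bool (l2 Q = AX) + count_label a A1 l Q = 1"
  have fin: "finite (labellings a)" by (rule finite_labellings[OF A(3)])
  have "arc_basis_mult (a, b, l1) (b, a, l2) = (\<Sum>l\<in>labellings a. if ?P l then frag_of (a, a, l) else 0)"
    unfolding mult_opposite[OF a b] by (rule sum.inter_filter[OF fin])
  also have "\<dots> = (\<Sum>D\<in>Pow a. if ?P (dot_labelling a D) then frag_of (a, a, dot_labelling a D) else 0)"
    by (rule sum.reindex_bij_betw[OF bij_betw_dot_labelling[OF A(1)], symmetric])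
  also have "\<dots> = (\<Sum>D\<in>Pow a. frag_extend diagram_to_arc
      (if \<forall>Q\<in>circles (a \<union> b). of_bool (l1 Q = AX) + of_bool (l2 Q = AX) + undotted a D Q = 1 then frag_of (a, D) else 0))"
    by (rule sum.cong) (simp_all add: count_label_dot_labelling[OF A(1,3)])
  also have "\<dots> = frag_extend diagram_to_arc
      (skein_sum a (circles (a \<union> b)) (\<lambda>Q. of_bool (l1 Q = AX) + of_bool (l2 Q = AX)))"
    unfolding skein_sum_def using A(3) by (simp add: frag_extend_sum comp_def)
  finally show ?thesis .
qed

lemma arc_to_diagram_diagram_to_arc:
  assumes "Poly_Mapping.keys x \<subseteq> diagrams n"
  shows "frag_extend arc_to_diagram (frag_extend diagram_to_arc x) = x"
  using assms
proof (induction x rule: frag_induction)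
  case (one x)
  then show ?case by (auto simp: diagrams_def dots_dot_labelling crossingless_matchingsD)
qed (simp_all add: frag_extend_diff)

lemma keys_skein_sum:
  assumes "m \<in> crossingless_matchings n" shows "Poly_Mapping.keys (skein_sum m P w) \<subseteq> diagrams n"
proof -
  have "skein_sum m P w \<in> carrier (free_Abelian_group (diagrams n))"
    unfolding skein_sum_def using assms
    by (intro sum_closed_free_Abelian_group) (auto simp: diagrams_def)
  then show ?thesis by simp
qed

lemma keys_frag_extend_subset:
  "Poly_Mapping.keys x \<subseteq> S \<Longrightarrow> (\<And>y. y \<in> S \<Longrightarrow> Poly_Mapping.keys (f y) \<subseteq> T) \<Longrightarrow> Poly_Mapping.keys (frag_extend f x) \<subseteq> T"
  using keys_frag_extend[of f x] by blast

section \<open>The commutator subgroup\<close>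

lemma straighten_in_labellings: "straighten d a l \<in> labellings (d \<union> a)"
  by (simp add: straighten_def labellings_def)

lemma keys_arc_basis_mult:
  assumes "x \<in> arc_ring_basis n" "y \<in> arc_ring_basis n"
  shows "Poly_Mapping.keys (arc_basis_mult x y) \<subseteq> arc_ring_basis n"
proof -
  obtain d c l1 b a l2 where xy: "x = (d, c, l1)" "y = (b, a, l2)" by (cases x, cases y)
  have "Poly_Mapping.keys (F_min_cobordism d b a l1 l2) \<subseteq> labellings (d \<union> a)"
    unfolding F_min_cobordism_def
    by (rule keys_frag_extend_subset[of _ UNIV]) (auto simp: straighten_in_labellings)
  then have "Poly_Mapping.keys (frag_extend (\<lambda>l. frag_of (d, a, l)) (F_min_cobordism d b a l1 l2)) \<subseteq> arc_ring_basis n"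
    by (rule keys_frag_extend_subset) (use assms xy in \<open>auto simp: arc_ring_basis_def\<close>)
  then show ?thesis unfolding xy by (cases "b = c") simp_all
qed

lemma frag_extend_diff_fun: "frag_extend (\<lambda>x. f x - g x) v = frag_extend f v - frag_extend g v"
  using subset_UNIV by (induction v rule: frag_induction) (simp_all add: frag_extend_diff)

lemma frag_extend_swap:
  "frag_extend (\<lambda>y. frag_extend (\<lambda>x. f x y) u) v = frag_extend (\<lambda>x. frag_extend (f x) v) u"
  using subset_UNIV by (induction u rule: frag_induction) (simp_all add: frag_extend_diff frag_extend_diff_fun, simp add: frag_extend_def)

text \<open>The bilinear form of the commutator, by which membership of all commutators in a
  subgroup need only be checked on pairs of basis elements.\<close>

definition arc_commutator :: "(arc_basis \<Rightarrow>\<^sub>0 int) \<Rightarrow> (arc_basis \<Rightarrow>\<^sub>0 int) \<Rightarrow> arc_basis \<Rightarrow>\<^sub>0 int" where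
  "arc_commutator u v = frag_extend (\<lambda>x. frag_extend (\<lambda>y. arc_basis_mult x y - arc_basis_mult y x) v) u"

lemma add_monoid_arc_ring: "add_monoid (arc_ring n) = free_Abelian_group (arc_ring_basis n)"
  by (simp add: arc_ring_def free_Abelian_group_def)

lemma arc_ring_commutator:
  assumes "u \<in> carrier (arc_ring n)" "v \<in> carrier (arc_ring n)"
  shows "u \<otimes>\<^bsub>arc_ring n\<^esub> v \<ominus>\<^bsub>arc_ring n\<^esub> v \<otimes>\<^bsub>arc_ring n\<^esub> u = arc_commutator u v"
proof -
  have uv: "Poly_Mapping.keys u \<subseteq> arc_ring_basis n" "Poly_Mapping.keys v \<subseteq> arc_ring_basis n"
    using assms by (simp_all add: arc_ring_def)
  let ?vu = "frag_extend (\<lambda>x. frag_extend (arc_basis_mult x) u) v"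
  have "Poly_Mapping.keys ?vu \<subseteq> arc_ring_basis n"
    by (intro keys_frag_extend_subset[OF uv(2)] keys_frag_extend_subset[OF uv(1)] keys_arc_basis_mult)
  then have "u \<otimes>\<^bsub>arc_ring n\<^esub> v \<ominus>\<^bsub>arc_ring n\<^esub> v \<otimes>\<^bsub>arc_ring n\<^esub> u =
      frag_extend (\<lambda>x. frag_extend (arc_basis_mult x) v) u - ?vu"
    unfolding a_minus_def a_inv_def add_monoid_arc_ring by (simp add: arc_ring_def)
  also have "\<dots> = arc_commutator u v"
    unfolding arc_commutator_def frag_extend_diff_fun frag_extend_swap[of "\<lambda>x y. arc_basis_mult y x" u v] ..
  finally show ?thesis .
qed

lemma commutator_subgroup_arc_ring:
  "commutator_subgroup (arc_ring n) = generate (free_Abelian_group (arc_ring_basis n))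
     {arc_commutator u v | u v. Poly_Mapping.keys u \<subseteq> arc_ring_basis n \<and> Poly_Mapping.keys v \<subseteq> arc_ring_basis n}"
proof -
  have carrier: "u \<in> carrier (arc_ring n) \<longleftrightarrow> Poly_Mapping.keys u \<subseteq> arc_ring_basis n" for u
    by (simp add: arc_ring_def)
  have "x = u \<otimes>\<^bsub>arc_ring n\<^esub> v \<ominus>\<^bsub>arc_ring n\<^esub> v \<otimes>\<^bsub>arc_ring n\<^esub> u \<and> u \<in> carrier (arc_ring n) \<and> v \<in> carrier (arc_ring n) \<longleftrightarrow>
      x = arc_commutator u v \<and> Poly_Mapping.keys u \<subseteq> arc_ring_basis n \<and> Poly_Mapping.keys v \<subseteq> arc_ring_basis n" for x u v
    unfolding carrier[symmetric] using arc_ring_commutator[of u n v] by metis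
  then show ?thesis unfolding commutator_subgroup_def add_monoid_arc_ring by simp
qed

abbreviation commutators :: "nat \<Rightarrow> (arc_basis \<Rightarrow>\<^sub>0 int) set" where
  "commutators n \<equiv> {arc_commutator u v | u v.
     Poly_Mapping.keys u \<subseteq> arc_ring_basis n \<and> Poly_Mapping.keys v \<subseteq> arc_ring_basis n}"

abbreviation commutator_group :: "nat \<Rightarrow> (arc_basis \<Rightarrow>\<^sub>0 int) set" where
  "commutator_group n \<equiv> generate (free_Abelian_group (arc_ring_basis n)) (commutators n)"

lemma keys_arc_commutator:
  assumes "Poly_Mapping.keys u \<subseteq> arc_ring_basis n" "Poly_Mapping.keys v \<subseteq> arc_ring_basis n"
  shows "Poly_Mapping.keys (arc_commutator u v) \<subseteq> arc_ring_basis n"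
  unfolding arc_commutator_def
  by (intro keys_frag_extend_subset[OF assms(1)] keys_frag_extend_subset[OF assms(2)] keys_diff_subset keys_arc_basis_mult)

lemma commutators_in_carrier: "commutators n \<subseteq> carrier (free_Abelian_group (arc_ring_basis n))"
proof
  fix x assume "x \<in> commutators n"
  then obtain u v where "x = arc_commutator u v" "Poly_Mapping.keys u \<subseteq> arc_ring_basis n" "Poly_Mapping.keys v \<subseteq> arc_ring_basis n"
    by blast
  then show "x \<in> carrier (free_Abelian_group (arc_ring_basis n))" using keys_arc_commutator by simp
qed

lemma subgroup_commutator_group: "subgroup (commutator_group n) (free_Abelian_group (arc_ring_basis n))"
  by (rule group.generate_is_subgroup[OF group_free_Abelian_group commutators_in_carrier])

lemma commutator_basis_in:
  assumes "x \<in> arc_ring_basis n" "y \<in> arc_ring_basis n"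
  shows "arc_basis_mult x y - arc_basis_mult y x \<in> commutator_group n"
proof -
  have "arc_commutator (frag_of x) (frag_of y) \<in> commutators n"
    using assms by (intro CollectI exI[of _ "frag_of x"] exI[of _ "frag_of y"]) simp
  from generate.incl[OF this] show ?thesis by (simp add: arc_commutator_def)
qed

lemma frag_extend_in_subgroup:
  assumes "subgroup H (free_Abelian_group T)" "Poly_Mapping.keys u \<subseteq> S" "\<And>x. x \<in> S \<Longrightarrow> f x \<in> H"
  shows "frag_extend f u \<in> H"
  using assms(2)
proof (induction u rule: frag_induction)
  case zero show ?case using subgroup_free_Abelian_group(1)[OF assms(1)] by simp
next
  case (one x) then show ?case using assms(3) by simp
next
  case (diff a b)
  then show ?case unfolding frag_extend_diff by (rule subgroup_free_Abelian_group(4)[OF assms(1)])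
qed

lemma arc_to_diagram_offdiagonal: "d \<noteq> a \<Longrightarrow> frag_extend arc_to_diagram (frag_extend (\<lambda>l. frag_of (d, a, l)) z) = 0"
  by (simp add: frag_extend_frag_extend frag_extend_eq_0)

lemma arc_to_diagram_commutator_basis:
  assumes "x \<in> arc_ring_basis n" "y \<in> arc_ring_basis n"
  shows "frag_extend arc_to_diagram (arc_basis_mult x y - arc_basis_mult y x) \<in> skein_relators n"
proof -
  note sg = subgroup_free_Abelian_group[OF subgroup_skein_relators]
  obtain d c l1 b a l2 where xy: "x = (d, c, l1)" "y = (b, a, l2)" by (cases x, cases y)
  have cm: "a \<in> crossingless_matchings n" "b \<in> crossingless_matchings n"
    using assms xy by (auto simp: arc_ring_basis_def)
  show ?thesis
  proof (cases "b = c \<and> d = a")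
    case False
    \<comment> \<open>The product \<open>x y\<close> needs \<open>b = c\<close> and lands in the
      summand of \<open>(d, a)\<close>; \<open>y x\<close> needs \<open>d = a\<close> and lands in
      that of \<open>(b, c)\<close>. If just one of these equations holds, the surviving product is
      off the diagonal.\<close>
    then have "frag_extend arc_to_diagram (arc_basis_mult x y) = 0" "frag_extend arc_to_diagram (arc_basis_mult y x) = 0"
      unfolding xy by (cases "b = c"; cases "d = a"; simp add: arc_to_diagram_offdiagonal)+
    then show ?thesis using sg(1) by (simp add: frag_extend_diff)
  next
    case True
    let ?w = "\<lambda>Q. of_bool (l1 Q = AX) + of_bool (l2 Q = AX) :: nat"
    have cd: "c = b" "d = a" using True by simp_all
    have 1: "frag_extend arc_to_diagram (arc_basis_mult x y) = skein_sum a (circles (a \<union> b)) ?w"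
      unfolding xy cd mult_opposite_skein_sum[OF cm]
      by (rule arc_to_diagram_diagram_to_arc[OF keys_skein_sum[OF cm(1)]])
    have w: "?w = (\<lambda>Q. of_bool (l2 Q = AX) + of_bool (l1 Q = AX))" by (simp add: add.commute)
    have 2: "frag_extend arc_to_diagram (arc_basis_mult y x) = skein_sum b (circles (a \<union> b)) ?w"
      unfolding xy cd mult_opposite_skein_sum[OF cm(2,1)] w Un_commute[of a b]
      by (rule arc_to_diagram_diagram_to_arc[OF keys_skein_sum[OF cm(2)]])
    show ?thesis unfolding frag_extend_diff 1 2
      by (rule skein_sum_independent[OF cm])
        (use crossingless_matchingsD[OF cm(1)] crossingless_matchingsD[OF cm(2)] in \<open>auto simp: Field_Un intro: conn_edge\<close>)
  qed
qed

lemma arc_to_diagram_commutator_group: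
  assumes "x \<in> commutator_group n" shows "frag_extend arc_to_diagram x \<in> skein_relators n"
proof -
  note sg = subgroup_free_Abelian_group[OF subgroup_skein_relators]
  have com: "frag_extend arc_to_diagram x \<in> skein_relators n" if x_in: "x \<in> commutators n" for x
  proof -
    obtain u v where x: "x = arc_commutator u v" and uv: "Poly_Mapping.keys u \<subseteq> arc_ring_basis n" "Poly_Mapping.keys v \<subseteq> arc_ring_basis n"
      using x_in by blast
    show ?thesis unfolding x arc_commutator_def frag_extend_frag_extend
      by (intro frag_extend_in_subgroup[OF subgroup_skein_relators uv(1)]
          frag_extend_in_subgroup[OF subgroup_skein_relators uv(2)] arc_to_diagram_commutator_basis)
  qed
  show ?thesis using assms
  proof (induction rule: generate.induct)
    case one show ?case using sg(1) by simp
  next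
    case (incl h) then show ?case by (rule com)
  next
    case (inv h)
    have "inv\<^bsub>free_Abelian_group (arc_ring_basis n)\<^esub> h = - h"
      using subsetD[OF commutators_in_carrier inv] by (simp only: carrier_free_Abelian_group_iff inv_free_Abelian_group)
    then show ?case using sg(3)[OF com[OF inv]] by (simp add: frag_extend_minus)
  next
    case (eng h1 h2)
    then show ?case using sg(2) by (simp add: frag_extend_add)
  qed
qed

lemma diagram_to_arc_arc_to_diagram:
  assumes "Poly_Mapping.keys x \<subseteq> arc_ring_basis n"
  shows "frag_extend diagram_to_arc (frag_extend arc_to_diagram x) - x \<in> commutator_group n"
proof -
  note sg = subgroup_free_Abelian_group[OF subgroup_commutator_group]
  show ?thesis using assms
  proof (induction x rule: frag_induction)
    case zero show ?case using sg(1) by simp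
  next
    case (one x)
    obtain b a l where x: "x = (b, a, l)" by (cases x)
    then have cm: "b \<in> crossingless_matchings n" "a \<in> crossingless_matchings n" "l \<in> labellings (b \<union> a)"
      using one by (auto simp: arc_ring_basis_def)
    show ?case
    proof (cases "b = a")
      case True
      then have "dot_labelling a (dots a l) = l"
        using cm crossingless_matchingsD(1) by (intro dot_labelling_dots) auto
      then show ?thesis using True x sg(1) by simp
    next
      case False
      let ?e = "(b, b, restrict (\<lambda>_. A1) (circles b))"
      have e: "?e \<in> arc_ring_basis n" using cm by (simp add: arc_ring_basis_def labellings_def)
      have "arc_basis_mult x ?e = 0" using False x by simp
      then have "frag_of x \<in> commutator_group n"
        using commutator_basis_in[OF e one] mult_unit_left[OF cm(2,1,3)] x by simp
      from sg(3)[OF this] show ?thesis using x False by simp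
    qed
  next
    case (diff a b)
    from sg(4)[OF this] show ?case by (simp add: frag_extend_diff algebra_simps)
  qed
qed

section \<open>Skein relations as commutators\<close>

lemma circles_surgery:
  assumes wxyz: "w < x" "x < y" "y < z"
    and m: "r \<union> {(w, x), (y, z)} \<in> crossingless_matchings n" "r \<union> {(w, z), (x, y)} \<in> crossingless_matchings n"
  shows "circles (r \<union> {(w, x), (y, z)} \<union> (r \<union> {(w, z), (x, y)})) = insert {w, x, y, z} (arc_set ` r)"
    "{w, x, y, z} \<inter> Field r = {}"
proof -
  let ?m = "r \<union> {(w, x), (y, z)}" and ?m' = "r \<union> {(w, z), (x, y)}"
  note A = crossingless_matchingsD(1)[OF m(1)] and B = crossingless_matchingsD(1)[OF m(2)]
  note nr = two_arcs_not_in[OF wxyz m]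
  have F: "i \<notin> {w, x, y, z} \<and> j \<notin> {w, x, y, z}" if "(i, j) \<in> r" for i j
  proof -
    have "(i, j) \<in> ?m" "(w, x) \<in> ?m" "(y, z) \<in> ?m" "(i, j) \<noteq> (w, x)" "(i, j) \<noteq> (y, z)"
      using that nr by blast+
    then show ?thesis using pmatchD[OF A, of i j w x] pmatchD[OF A, of i j y z] by blast
  qed
  then show "{w, x, y, z} \<inter> Field r = {}" unfolding Field_iff[abs_def] disjoint_iff by blast
  have big: "circle_of (?m \<union> ?m') k = {w, x, y, z}" if "k \<in> {w, x, y, z}" for k
  proof
    show "circle_of (?m \<union> ?m') k \<subseteq> {w, x, y, z}"
      by (rule circle_of_subset_closed[OF that]) (use F in blast)
    have e: "(w, x) \<in> conn (?m \<union> ?m')" "(x, y) \<in> conn (?m \<union> ?m')" "(y, z) \<in> conn (?m \<union> ?m')"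
      by (auto intro: conn_edge)
    have w: "(w, u) \<in> conn (?m \<union> ?m')" if "u \<in> {w, x, y, z}" for u
      using that e conn_trans[OF e(1,2)] conn_trans[OF conn_trans[OF e(1,2)] e(3)] by auto
    show "{w, x, y, z} \<subseteq> circle_of (?m \<union> ?m') k"
      using conn_trans[OF conn_sym[OF w[OF that]] w] by (auto simp: in_circle_of)
  qed
  have small: "circle_of (?m \<union> ?m') i = arc_set (i, j)" "circle_of (?m \<union> ?m') j = arc_set (i, j)"
    if "(i, j) \<in> r" for i j
    using circle_of_common_arc[OF A B, of i j] that by (simp_all add: arc_set_def)
  have Fm: "Field (?m \<union> ?m') = {w, x, y, z} \<union> Field r" by (auto simp: Field_def)
  show "circles (?m \<union> ?m') = insert {w, x, y, z} (arc_set ` r)"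
  proof (intro equalityI subsetI)
    fix c assume "c \<in> circles (?m \<union> ?m')"
    then obtain k where k: "k \<in> {w, x, y, z} \<union> Field r" "c = circle_of (?m \<union> ?m') k"
      unfolding circles_def Fm by blast
    then consider "k \<in> {w, x, y, z}" | j where "(k, j) \<in> r" | j where "(j, k) \<in> r"
      unfolding Un_iff Field_iff by blast
    then show "c \<in> insert {w, x, y, z} (arc_set ` r)"
    proof cases
      case 1 then show ?thesis using big k(2) by simp
    next
      case 2 then show ?thesis using small(1) k(2) by blast
    next
      case 3 then show ?thesis using small(2) k(2) by blast
    qed
  next
    fix c assume "c \<in> insert {w, x, y, z} (arc_set ` r)"
    then consider "c = {w, x, y, z}" | i j where "(i, j) \<in> r" "c = arc_set (i, j)" by force
    then show "c \<in> circles (?m \<union> ?m')"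
    proof cases
      case 1
      then have "c = circle_of (?m \<union> ?m') w" using big[of w] by simp
      then show ?thesis using Fm by (auto intro: circle_of_in_circles)
    next
      case 2
      then have "c = circle_of (?m \<union> ?m') i" using small(1) by simp
      then show ?thesis using Fm FieldI1[OF 2(1)] by (auto intro: circle_of_in_circles)
    qed
  qed
qed

text \<open>Each common arc is a circle of its own, on which the weight prescribes whether it is
  dotted, so only the dotting \<open>D\<close> survives. The common arcs do not meet
  \<open>c0\<close>, where only the weight itself remains.\<close>

lemma skein_sum_common_arcs:
  assumes r: "finite r" "pmatch r" "D \<subseteq> r" "(i, j) \<notin> r" "(k, l) \<notin> r" "(i, j) \<noteq> (k, l)"
    and c: "{i, j, k, l} = c0" "c0 \<inter> Field r = {}"
    and v: "\<And>e. e \<in> r \<Longrightarrow> v (arc_set e) = of_bool (e \<in> D)"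
  shows "skein_sum (r \<union> {(i, j), (k, l)}) (insert c0 (arc_set ` r)) v = two_arcs_term r (i, j) (k, l) (v c0) D"
proof -
  have dis: "arc_set e \<inter> c0 = {}" if "e \<in> r" for e
    using that c(2) FieldI1[of "fst e" "snd e" r] FieldI2[of "fst e" "snd e" r] by (auto simp: arc_set_def)
  have ne: "arc_set e \<noteq> c0" if "e \<in> r" for e using dis[OF that] by (auto simp: arc_set_def)
  have u0: "undotted r D' c0 = 0" for D'
  proof -
    have "{(i, j) \<in> r - D'. i \<in> c0 \<and> j \<in> c0} = {}" using dis unfolding arc_set_def by fastforce
    then show ?thesis unfolding undotted_def by (simp only: card.empty)
  qed
  have u: "undotted r D' (arc_set e) = of_bool (e \<notin> D')" if e: "e \<in> r" for e D'
  proof -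
    obtain s t where st: "e = (s, t)" by (cases e)
    have sub: "(i, j) = (s, t)" if "(i, j) \<in> r" "i \<in> {s, t}" for i j
      using pmatchD[OF r(2) that(1), of s t] e that(2) unfolding st by blast
    have mem: "p \<in> {(i, j) \<in> r - D'. i \<in> arc_set e \<and> j \<in> arc_set e} \<longleftrightarrow> p = e \<and> e \<notin> D'" for p
    proof -
      obtain i j where p: "p = (i, j)" by (cases p)
      show ?thesis unfolding p mem_Collect_eq case_prod_conv arc_set_def st fst_conv snd_conv
        using sub[of i j] e unfolding st by blast
    qed
    have "{(i, j) \<in> r - D'. i \<in> arc_set e \<and> j \<in> arc_set e} = (if e \<in> D' then {} else {e})"
    proof (rule Set.set_eqI)
      show "p \<in> {(i, j) \<in> r - D'. i \<in> arc_set e \<and> j \<in> arc_set e} \<longleftrightarrow> p \<in> (if e \<in> D' then {} else {e})" for p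
        unfolding mem by simp
    qed
    then show ?thesis unfolding undotted_def by simp
  qed
  have P: "insert c0 (arc_set ` r) - {c0} = arc_set ` r" using ne by blast
  have A: "(\<forall>c\<in>insert c0 (arc_set ` r) - {c0}. v c + undotted r D' c = 1) \<longleftrightarrow> D' = D" if "D' \<subseteq> r" for D'
  proof -
    have "v (arc_set e) + undotted r D' (arc_set e) = 1 \<longleftrightarrow> (e \<in> D' \<longleftrightarrow> e \<in> D)" if "e \<in> r" for e
      using u[OF that] v[OF that] by auto
    then have "(\<forall>e\<in>r. v (arc_set e) + undotted r D' (arc_set e) = 1) \<longleftrightarrow> (\<forall>e\<in>r. e \<in> D' \<longleftrightarrow> e \<in> D)" by simp
    also have "\<dots> \<longleftrightarrow> D' = D" using that r(3) by blast
    finally show ?thesis unfolding P by simp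
  qed
  have "skein_sum (r \<union> {(i, j), (k, l)}) (insert c0 (arc_set ` r)) v =
    (\<Sum>D'\<in>Pow r. if \<forall>c\<in>insert c0 (arc_set ` r) - {c0}. v c + undotted r D' c = 1
      then two_arcs_term r (i, j) (k, l) (v c0 + undotted r D' c0) D' else 0)"
    by (rule skein_sum_two_arcs) (use r c dis in auto)
  also have "\<dots> = (\<Sum>D'\<in>Pow r. if D' = D then two_arcs_term r (i, j) (k, l) (v c0) D' else 0)"
    by (rule sum.cong[OF refl]) (simp only: A u0 Pow_iff add_0_right)
  also have "\<dots> = two_arcs_term r (i, j) (k, l) (v c0) D"
    using r(1,3) by (simp add: sum.delta)
  finally show ?thesis .
qed

lemma restrict_in_labellings: "restrict f (circles E) \<in> labellings E"
  by (simp add: labellings_def)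

lemma diagram_to_arc_relation:
  assumes wxyz: "w < x" "x < y" "y < z" and D: "D \<subseteq> r"
    and m: "r \<union> {(w, x), (y, z)} \<in> crossingless_matchings n" "r \<union> {(w, z), (x, y)} \<in> crossingless_matchings n"
    and s: "s \<le> 1"
  shows "frag_extend diagram_to_arc (two_arcs_term r (w, x) (y, z) s D - two_arcs_term r (w, z) (x, y) s D)
    \<in> commutator_group n"
proof -
  let ?m = "r \<union> {(w, x), (y, z)}" and ?m' = "r \<union> {(w, z), (x, y)}"
  let ?c0 = "{w, x, y, z}"
  \<comment> \<open>The label \<open>X\<close> marks the dotted common arcs. The large circle gets
    \<open>1\<close> for a type I relation and \<open>X\<close> for type II. The second factor is
    \<open>1\<close> throughout, so \<open>l1\<close> alone determines the weight.\<close>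
  define l1 where "l1 = restrict (\<lambda>Q. if Q \<in> arc_set ` D \<or> s = 1 \<and> Q = ?c0 then AX else A1) (circles (?m \<union> ?m'))"
  define l2 where "l2 = restrict (\<lambda>Q. A1) (circles (?m \<union> ?m'))"
  define v where "v Q = (of_bool (l1 Q = AX) + of_bool (l2 Q = AX) :: nat)" for Q
  note C = circles_surgery[OF wxyz m] and nr = two_arcs_not_in[OF wxyz m]
  have pr: "pmatch r" using crossingless_matchingsD(1)[OF m(1)] by (rule pmatch_subset) auto
  have Q: "Q \<in> circles (?m \<union> ?m') \<Longrightarrow> v Q = of_bool (Q \<in> arc_set ` D \<or> s = 1 \<and> Q = ?c0)" for Q
    by (simp add: v_def l1_def l2_def)
  have ne: "arc_set e \<noteq> ?c0" if "e \<in> r" for e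
    using that C(2) FieldI1[of "fst e" "snd e" r] by (force simp: arc_set_def)
  have v: "v (arc_set e) = of_bool (e \<in> D)" if e: "e \<in> r" for e
  proof -
    have "arc_set e \<in> circles (?m \<union> ?m')" unfolding C(1) using e by blast
    moreover have "arc_set e \<in> arc_set ` D \<longleftrightarrow> e \<in> D"
      by (rule inj_on_image_mem_iff[OF arc_set_inj[OF pr] e D])
    ultimately show ?thesis using Q[of "arc_set e"] ne[OF e] by simp
  qed
  have v0: "v ?c0 = s"
  proof -
    have "?c0 \<in> circles (?m \<union> ?m')" unfolding C(1) by blast
    moreover have "?c0 \<notin> arc_set ` D" using ne D by blast
    ultimately show ?thesis using Q[of ?c0] s by (cases s) auto
  qed
  have 1: "skein_sum ?m (circles (?m \<union> ?m')) v = two_arcs_term r (w, x) (y, z) s D"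
    unfolding C(1) v0[symmetric] by (rule skein_sum_common_arcs) (use nr pr D C(2) v wxyz in auto)
  have 2: "skein_sum ?m' (circles (?m \<union> ?m')) v = two_arcs_term r (w, z) (x, y) s D"
    unfolding C(1) v0[symmetric] by (rule skein_sum_common_arcs) (use nr pr D C(2) v wxyz in auto)
  have l1_in: "l1 \<in> labellings (?m \<union> ?m')" unfolding l1_def by (rule restrict_in_labellings)
  have l2_in: "l2 \<in> labellings (?m' \<union> ?m)"
    unfolding l2_def Un_commute[of ?m' ?m] by (rule restrict_in_labellings)
  have "(?m, ?m', l1) \<in> arc_ring_basis n" "(?m', ?m, l2) \<in> arc_ring_basis n"
    using m l1_in l2_in unfolding arc_ring_basis_def by blast+
  from commutator_basis_in[OF this]
  have "arc_basis_mult (?m, ?m', l1) (?m', ?m, l2) - arc_basis_mult (?m', ?m, l2) (?m, ?m', l1) \<in> commutator_group n" .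
  moreover have "arc_basis_mult (?m, ?m', l1) (?m', ?m, l2) =
      frag_extend diagram_to_arc (skein_sum ?m (circles (?m \<union> ?m')) v)"
    unfolding mult_opposite_skein_sum[OF m] v_def[abs_def] ..
  moreover have "v = (\<lambda>Q. of_bool (l2 Q = AX) + of_bool (l1 Q = AX))" by (auto simp: v_def)
  then have "arc_basis_mult (?m', ?m, l2) (?m, ?m', l1) =
      frag_extend diagram_to_arc (skein_sum ?m' (circles (?m \<union> ?m')) v)"
    unfolding mult_opposite_skein_sum[OF m(2,1)] Un_commute[of ?m' ?m] by simp
  ultimately show ?thesis unfolding 1 2 frag_extend_diff by simp
qed

lemma diagram_to_arc_skein_relators:
  assumes "x \<in> skein_relators n" shows "frag_extend diagram_to_arc x \<in> commutator_group n"
proof -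
  note sg = subgroup_free_Abelian_group[OF subgroup_commutator_group]
  have rel: "frag_extend diagram_to_arc h \<in> commutator_group n"
    if h: "h \<in> type_I_relations n \<union> type_II_relations n" for h
  proof -
    obtain a b c d r D s where "a < b" "b < c" "c < d" "D \<subseteq> r"
      "r \<union> {(a, b), (c, d)} \<in> crossingless_matchings n" "r \<union> {(a, d), (b, c)} \<in> crossingless_matchings n"
      and "s \<le> 1" "h = two_arcs_term r (a, b) (c, d) s D - two_arcs_term r (a, d) (b, c) s D"
    proof (cases "h \<in> type_I_relations n")
      case True
      then show thesis using that[where s = 0] unfolding type_I_relations_def two_arcs_term_def by auto
    next
      case False
      then have "h \<in> type_II_relations n" using h by blast
      then show thesis using that[where s = 1] unfolding type_II_relations_def two_arcs_term_def by auto
    qed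
    then show ?thesis using diagram_to_arc_relation by blast
  qed
  show ?thesis using assms
  proof (induction rule: generate.induct)
    case one show ?case using sg(1) by simp
  next
    case (incl h) then show ?case by (rule rel)
  next
    case (inv h)
    have "inv\<^bsub>free_Abelian_group (diagrams n)\<^esub> h = - h"
      using subsetD[OF relations_in_carrier inv] by (simp only: carrier_free_Abelian_group_iff inv_free_Abelian_group)
    then show ?case using sg(3)[OF rel[OF inv]] by (simp add: frag_extend_minus)
  next
    case (eng h1 h2)
    then show ?case using sg(2) by (simp add: frag_extend_add)
  qed
qed

lemma keys_arc_to_diagram:
  "Poly_Mapping.keys x \<subseteq> arc_ring_basis n \<Longrightarrow> Poly_Mapping.keys (frag_extend arc_to_diagram x) \<subseteq> diagrams n"
  by (erule keys_frag_extend_subset)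
    (auto simp: arc_ring_basis_def diagrams_def dots_def split: if_splits)

lemma keys_diagram_to_arc:
  "Poly_Mapping.keys x \<subseteq> diagrams n \<Longrightarrow> Poly_Mapping.keys (frag_extend diagram_to_arc x) \<subseteq> arc_ring_basis n"
  by (erule keys_frag_extend_subset)
    (auto simp: arc_ring_basis_def diagrams_def dot_labelling_in_labellings)

theorem proposition5p1p2:
  fixes n :: nat
  shows "HH0 (arc_ring n) \<cong> russell_skein_module n"
proof -
  let ?B = "free_Abelian_group (arc_ring_basis n)" and ?R = "free_Abelian_group (diagrams n)"
  let ?\<phi> = "frag_extend arc_to_diagram" and ?\<psi> = "frag_extend diagram_to_arc"
  let ?q = "\<lambda>x. skein_relators n #>\<^bsub>?R\<^esub> x"
  have nor: "normal (skein_relators n) ?R"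
    by (rule comm_group.subgroup_imp_normal[OF abelian_free_Abelian_group subgroup_skein_relators])
  have "?\<phi> \<in> hom ?B ?R" by (rule homI) (simp_all add: keys_arc_to_diagram frag_extend_add)
  then have hom: "(\<lambda>x. ?q (?\<phi> x)) \<in> hom ?B (?R Mod skein_relators n)"
    using hom_compose[OF _ normal.r_coset_hom_Mod[OF nor]] by (simp add: comp_def)
  interpret group_hom ?B "?R Mod skein_relators n" "\<lambda>x. ?q (?\<phi> x)"
    by (intro group_hom.intro group_hom_axioms.intro hom normal.factorgroup_is_group[OF nor] group_free_Abelian_group)
  \<comment> \<open>The first isomorphism theorem is applied to \<open>?\<phi>\<close> followed by
    the quotient map. The section \<open>?\<psi>\<close> serves both for the kernel and for
    surjectivity.\<close>
  have "kernel ?B (?R Mod skein_relators n) (\<lambda>x. ?q (?\<phi> x)) = commutator_group n"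
  proof (intro equalityI subsetI)
    fix x assume "x \<in> kernel ?B (?R Mod skein_relators n) (\<lambda>x. ?q (?\<phi> x))"
    then have x: "Poly_Mapping.keys x \<subseteq> arc_ring_basis n" and q: "?q (?\<phi> x) = skein_relators n"
      by (simp_all add: kernel_def FactGroup_def)
    have "?\<phi> x \<in> skein_relators n"
      by (rule group.coset_join1[OF group_free_Abelian_group q _ subgroup_skein_relators])
        (simp add: keys_arc_to_diagram[OF x])
    then have "?\<psi> (?\<phi> x) \<in> commutator_group n" by (rule diagram_to_arc_skein_relators)
    \<comment> \<open>Both \<open>?\<psi> (?\<phi> x)\<close> and its difference from
      \<open>x\<close> lie in the commutator subgroup.\<close>
    from subgroup_free_Abelian_group(4)[OF subgroup_commutator_group this diagram_to_arc_arc_to_diagram[OF x]]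
    show "x \<in> commutator_group n" by simp
  next
    fix x assume x: "x \<in> commutator_group n"
    then have k: "x \<in> carrier ?B" by (rule subgroup.mem_carrier[OF subgroup_commutator_group])
    have "?q (?\<phi> x) = skein_relators n"
      by (rule group.coset_join2[OF group_free_Abelian_group _ subgroup_skein_relators arc_to_diagram_commutator_group[OF x]])
        (use k keys_arc_to_diagram in auto)
    then show "x \<in> kernel ?B (?R Mod skein_relators n) (\<lambda>x. ?q (?\<phi> x))"
      using k by (simp add: kernel_def FactGroup_def)
  qed
  moreover have "(\<lambda>x. ?q (?\<phi> x)) ` carrier ?B = carrier (?R Mod skein_relators n)"
  proof (intro equalityI subsetI)
    fix X assume "X \<in> (\<lambda>x. ?q (?\<phi> x)) ` carrier ?B"
    then show "X \<in> carrier (?R Mod skein_relators n)" using hom by (auto dest: hom_closed)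
  next
    fix X assume "X \<in> carrier (?R Mod skein_relators n)"
    then obtain y where y: "Poly_Mapping.keys y \<subseteq> diagrams n" "X = ?q y"
      by (auto simp: FactGroup_def RCOSETS_def)
    then have "X = ?q (?\<phi> (?\<psi> y))" by (simp add: arc_to_diagram_diagram_to_arc)
    then show "X \<in> (\<lambda>x. ?q (?\<phi> x)) ` carrier ?B" using keys_diagram_to_arc[OF y(1)] by auto
  qed
  ultimately show ?thesis
    using FactGroup_iso unfolding HH0_def A_FactGroup_def add_monoid_arc_ring commutator_subgroup_arc_ring
      russell_skein_module_def by simp
qed

end
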